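(* For every integer $d \ge 2$ and each $k \in \{3, 5\}$, there exists no $d$-dimensional minimal cubature formula of degree $4k+1$ (that is, of degree $13$ for $k=3$ and of degree $21$ for $k=5$) for the integral $$\mathcal{I}_k[f] = \int_{\{x \in \mathbb{R}^d \,:\, 1 \le \|x\| < \infty\}} f(x)\, \frac{\sqrt{\|x\|^2 - 1}}{\|x\|^{4k+d+2}}\,dx = \int_1^\infty \Big(\int_{S^{d-1}} f(rx)\,d\rho(x)\Big) \sqrt{r^2-1}\; r^{-(4k+3)}\,dr .$$
   Context: $\rho$ is the surface measure on the unit sphere $S^{d-1} \subset \mathbb{R}^d$. For polynomials $f$ of degree at most $4k+1$ the integral $\mathcal{I}_k[f]$ is understood as the iterated integral on the right-hand side (the inner spherical integral of an odd-degree homogeneous polynomial is $0$, so the iterated integral converges for all such $f$). Cubature formula of degree $t$: a finite set $X \subset \mathbb{R}^d$ of distinct points (not required to lie in $\Omega = \{x : \|x\| \ge 1\}$) with positive weights $w(x)$, $x \in X$, such that $\mathcal{I}_k[f] = \sum_{x \in X} w(x) f(x)$ for all polynomials $f$ of degree at most $t$. Let $\mathcal{P}^*_{2k}(\Omega)$ be the space of even polynomials (polynomials $f$ with $f(-x)=f(x)$) of degree at most $2k$, restricted to $\Omega$. A cubature formula of degree $4k+1$ is minimal if it attains the Möller lower bound, i.e. $0 \in X$ and $|X| = 2\dim \mathcal{P}^*_{2k}(\Omega) - 1$. *)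

theory Defs
  imports "HOL-Analysis.Analysis" "HOL-Library.Function_Algebras"
begin

definition monomial_fun :: "('n::finite \<Rightarrow> nat) \<Rightarrow> real ^ 'n \<Rightarrow> real" where
  "monomial_fun \<alpha> x = (\<Prod>i\<in>UNIV. (x $ i) ^ \<alpha> i)"

lemma finite_multi_indices: "finite {\<alpha> :: 'n::finite \<Rightarrow> nat. sum \<alpha> UNIV \<le> t}"
proof (rule finite_subset)
  show "{\<alpha> :: 'n \<Rightarrow> nat. sum \<alpha> UNIV \<le> t} \<subseteq> (UNIV :: 'n set) \<rightarrow>\<^sub>E {..t}"
  proof
    fix \<alpha> :: "'n \<Rightarrow> nat"
    assume "\<alpha> \<in> {\<alpha>. sum \<alpha> UNIV \<le> t}"
    then have "\<alpha> i \<le> t" for i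
      using member_le_sum[of i UNIV \<alpha>] by (auto intro: order_trans)
    then show "\<alpha> \<in> UNIV \<rightarrow>\<^sub>E {..t}" by auto
  qed
  show "finite ((UNIV :: 'n set) \<rightarrow>\<^sub>E {..t})" by (intro finite_PiE) auto
qed

text \<open>Polynomials are identified with the functions they induce on the whole space, which is
  harmless over the reals. The index set of the sum is finite by the lemma above.\<close>

definition polys :: "nat \<Rightarrow> (real ^ 'n::finite \<Rightarrow> real) set" where
  "polys t = {f. \<exists>c. f = (\<lambda>x. \<Sum>\<alpha> | sum \<alpha> UNIV \<le> t. c \<alpha> * monomial_fun \<alpha> x)}"

definition Omega :: "(real ^ 'n::finite) set" where
  "Omega = {x. norm x \<ge> 1}"

text \<open>A function on \<open>Omega\<close> is represented by its extension by zero, so that the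
  restrictions form a linear subspace of the space of all functions.\<close>

definition even_polys_Omega :: "nat \<Rightarrow> (real ^ 'n::finite \<Rightarrow> real) set" where
  "even_polys_Omega t =
     {\<lambda>x. if x \<in> Omega then f x else 0 | f. f \<in> polys t \<and> (\<forall>x. f (- x) = f x)}"

interpretation fun_space: vector_space "\<lambda>(c::real) (f :: 'a \<Rightarrow> real) x. c * f x"
  by unfold_locales (auto simp: fun_eq_iff algebra_simps)

text \<open>Surface measure on the unit sphere in dimension \<open>d\<close>, normalised as in polar
  coordinates: the measure of \<open>A\<close> is \<open>d\<close> times the Lebesgue measure of the cone over \<open>A\<close>
  inside the unit ball. The map \<open>sgn\<close> is the radial projection onto the sphere.\<close>

definition sphere_measure :: "(real ^ 'n::finite) measure" where
  "sphere_measure = scale_measure (of_nat CARD('n))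
     (distr (restrict_space lborel (ball 0 1 - {0})) (restrict_space borel (sphere 0 1)) sgn)"

lemma measurable_sgn_sphere:
  "sgn \<in> restrict_space lborel (ball 0 1 - {0 :: real ^ 'n::finite})
         \<rightarrow>\<^sub>M restrict_space borel (sphere 0 1)"
proof (rule measurable_restrict_space2)
  show "sgn \<in> space (restrict_space lborel (ball 0 1 - {0 :: real ^ 'n})) \<rightarrow> sphere 0 1"
    by (auto simp: space_restrict_space norm_sgn)
  have "(\<lambda>x :: real ^ 'n. inverse (norm x) *\<^sub>R x) \<in> borel_measurable borel"
    by measurable
  then have "(sgn :: real ^ 'n \<Rightarrow> _) \<in> borel_measurable lborel"
    by (simp add: sgn_div_norm)
  then show "(sgn :: real ^ 'n \<Rightarrow> _) \<in> borel_measurable (restrict_space lborel (ball 0 1 - {0}))"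
    by (rule measurable_restrict_space1)
qed

lemma emeasure_sphere_measure:
  assumes "A \<in> sets borel" "A \<subseteq> sphere (0 :: real ^ 'n::finite) 1"
  shows "emeasure sphere_measure A =
    of_nat CARD('n) * emeasure lborel {x \<in> ball 0 1 - {0}. sgn x \<in> A}"
proof -
  have "A \<in> sets (restrict_space borel (sphere 0 1))"
    using assms by (auto simp: sets_restrict_space_iff)
  moreover have "sgn -` A \<inter> space (restrict_space lborel (ball 0 1 - {0})) =
      {x \<in> ball 0 1 - {0}. sgn x \<in> A}"
    by (auto simp: space_restrict_space)
  ultimately show ?thesis
    by (simp add: sphere_measure_def emeasure_distr[OF measurable_sgn_sphere]
        emeasure_restrict_space subset_eq)
qed

text \<open>Over the region \<open>Omega\<close> the weighted integral of an odd polynomial of top degree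
  \<open>4 * k + 1\<close> need not converge absolutely, hence the iterated form: the spherical integral is taken
  first and annihilates the odd part. The radial weight is
  \<open>sqrt (r\<^sup>2 - 1) / r ^ (4 * k + d + 2)\<close> times the Jacobian \<open>r ^ (d - 1)\<close>.\<close>

definition weighted_integral :: "nat \<Rightarrow> (real ^ 'n::finite \<Rightarrow> real) \<Rightarrow> real" where
  "weighted_integral k f =
     (LINT r:{1..}|lborel.
        (LINT x|sphere_measure. f (r *\<^sub>R x)) * sqrt (r\<^sup>2 - 1) / r ^ (4 * k + 3))"

definition cubature_formula ::
  "((real ^ 'n::finite \<Rightarrow> real) \<Rightarrow> real) \<Rightarrow> nat \<Rightarrow> (real ^ 'n) set \<Rightarrow> (real ^ 'n \<Rightarrow> real) \<Rightarrow> bool"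
where
  "cubature_formula I t X w \<longleftrightarrow>
     finite X \<and> (\<forall>x\<in>X. w x > 0) \<and> (\<forall>f\<in>polys t. I f = (\<Sum>x\<in>X. w x * f x))"

definition minimal_cubature_formula ::
  "nat \<Rightarrow> (real ^ 'n::finite) set \<Rightarrow> (real ^ 'n \<Rightarrow> real) \<Rightarrow> bool"
where
  "minimal_cubature_formula k X w \<longleftrightarrow>
     cubature_formula (weighted_integral k) (4 * k + 1) X w \<and> 0 \<in> X \<and>
     int (card X) =
       2 * int (fun_space.dim (even_polys_Omega (2 * k) :: (real ^ 'n \<Rightarrow> real) set)) - 1"

end

theory Submission
  imports Defs "HOL-Computational_Algebra.Polynomial_Factorial"
begin

text \<open>Suppose a minimal formula of degree \<open>4 * k + 1\<close> exists. Let \<open>E\<close> be the space of even polynomials of degree at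
  most \<open>2 * k\<close> and \<open>Z\<close> the set of nodes other than the origin. The idea is to compute the number of nodes on a
  sphere around the origin and to see that it is irrational.

  The formula is exact on products of two elements of \<open>E\<close>, and it annihilates the products of a linear form and
  two elements of \<open>E\<close>, which are odd. As \<open>Z\<close> has exactly \<open>2 * dim E - 2\<close> elements, the restriction of \<open>E\<close> to \<open>Z\<close> and
  its multiple by a linear form without zeros on \<open>Z\<close> are orthogonal complements of each other. So the restriction
  is closed under multiplication by quotients of linear forms (\<open>exchange_linear_factor\<close>), and it contains, for every
  \<open>x \<in> Z\<close>, the function that is \<open>1\<close> at \<open>x\<close> and \<open>- x\<close> and \<open>0\<close> at the other nodes (\<open>node_polynomial\<close>). Hence the
  formula is antipodal, and the weight of \<open>x\<close> is \<open>1 / (2 * K x x)\<close>, where \<open>K\<close> is the reproducing kernel of \<open>E\<close> for the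
  given integral (\<open>antipodal\<close>, \<open>node_weight\<close>).

  The kernel is explicit. Divided by \<open>r ^ (4 * k)\<close>, even powers of \<open>r\<close> of exponent at most \<open>4 * k\<close> are polynomials in
  \<open>s = 1 / r\<^sup>2\<close>, and the radial weight becomes a multiple of \<open>sqrt ((1 - s) / s)\<close> on \<open>[0, 1]\<close>, whose
  orthogonal polynomials \<open>cheb a\<close> are Chebyshev polynomials of the fourth kind. With \<open>H j\<close> the dimension of the
  space of forms of degree \<open>2 * j\<close>, rotation invariance shows that \<open>K x x\<close> is a constant multiple of
  \<open>r ^ (4 * k)\<close> times the sum of \<open>H (k - a) * (cheb a s)\<^sup>2\<close> over \<open>a \<le> k\<close>. The nodes in \<open>Z\<close> lie on spheres with
  \<open>cheb k s = 0\<close> (\<open>node_radius_root\<close>), and the total weight of a sphere is a Gauss weight. Dividing by the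
  weight of one node, the number \<open>n\<close> of nodes on the sphere satisfies (\<open>layer_count\<close>)
  \<open>(\<Sum>a\<le>k. (2 * H (k - a) - n) * (cheb a s)\<^sup>2) = 0\<close>.

  Here \<open>s = (cos t)\<^sup>2\<close> with \<open>t\<close> a multiple of \<open>\<pi> / (2 * k + 1)\<close>. For \<open>k = 3\<close> and \<open>k = 5\<close> the number \<open>2 * k + 1\<close> is
  prime, and the values \<open>(cheb a s)\<^sup>2\<close> for \<open>a < k\<close> are linearly independent over the rationals. So the relation
  forces \<open>H 1 = \<dots> = H k = n / 2\<close>, whereas \<open>H 1 < H 2\<close> in every dimension \<open>d \<ge> 2\<close>.\<close>

section \<open>Forms: homogeneous polynomials\<close>

definition forms :: "nat \<Rightarrow> (real ^ 'n::finite \<Rightarrow> real) set" where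
  "forms m = fun_space.span (monomial_fun ` {\<alpha>. sum \<alpha> UNIV = m})"

lemma subspace_forms: "fun_space.subspace (forms m)"
  by (simp add: forms_def)

lemma forms_add: "f \<in> forms m \<Longrightarrow> g \<in> forms m \<Longrightarrow> (\<lambda>x. f x + g x) \<in> forms m"
  using fun_space.subspace_add[OF subspace_forms] by (fastforce simp: plus_fun_def)

lemma forms_scale: "f \<in> forms m \<Longrightarrow> (\<lambda>x. c * f x) \<in> forms m"
  using fun_space.subspace_scale[OF subspace_forms] by blast

lemma forms_zero: "(\<lambda>x. 0) \<in> forms m"
  using fun_space.subspace_0[OF subspace_forms] by (simp add: zero_fun_def)

lemma forms_sum: "(\<And>i. i \<in> A \<Longrightarrow> f i \<in> forms m) \<Longrightarrow> (\<lambda>x. \<Sum>i\<in>A. f i x) \<in> forms m"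
  by (induction A rule: infinite_finite_induct) (auto simp: forms_zero forms_add)

lemma monomial_in_forms: "sum \<alpha> UNIV = m \<Longrightarrow> monomial_fun \<alpha> \<in> forms m"
  unfolding forms_def by (intro fun_space.span_base) auto

lemma forms_induct [consumes 1, case_names zero add]:
  assumes "f \<in> forms m" "P (\<lambda>x. 0)"
    "\<And>c \<alpha> g. sum \<alpha> UNIV = m \<Longrightarrow> g \<in> forms m \<Longrightarrow> P g \<Longrightarrow> P (\<lambda>x. c * monomial_fun \<alpha> x + g x)"
  shows "P f"
proof -
  have "f \<in> forms m \<and> P f"
    using assms(1) unfolding forms_def
  proof (induction rule: fun_space.span_induct_alt)
    case base
    then show ?case using assms(2) fun_space.span_zero by (simp add: zero_fun_def)
  next
    case (step c x y)
    then obtain \<alpha> where \<alpha>: "sum \<alpha> UNIV = m" "x = monomial_fun \<alpha>" by auto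
    have "y \<in> forms m" using step by (simp add: forms_def)
    then have "P (\<lambda>z. c * monomial_fun \<alpha> z + y z)"
      using step \<alpha> assms(3) by blast
    moreover have "(\<lambda>z. c * monomial_fun \<alpha> z + y z) \<in> forms m"
      using \<alpha> \<open>y \<in> forms m\<close> by (intro forms_add forms_scale monomial_in_forms)
    moreover have "(\<lambda>z. c * x z) + y = (\<lambda>z. c * monomial_fun \<alpha> z + y z)"
      by (simp add: plus_fun_def \<alpha>)
    ultimately show ?case by (simp add: forms_def)
  qed
  then show ?thesis by simp
qed

lemma monomial_mult: "monomial_fun \<alpha> x * monomial_fun \<beta> x = monomial_fun (\<lambda>i. \<alpha> i + \<beta> i) x"
  by (simp add: monomial_fun_def power_add prod.distrib)

lemma forms_mult:
  assumes "f \<in> forms m" "g \<in> forms n"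
  shows "(\<lambda>x. f x * g x) \<in> forms (m + n)"
  using assms(1)
proof (induction rule: forms_induct)
  case zero
  then show ?case by (simp add: forms_zero)
next
  case (add c \<alpha> f)
  have "(\<lambda>x. monomial_fun \<alpha> x * g x) \<in> forms (m + n)"
    using assms(2)
  proof (induction rule: forms_induct)
    case zero
    then show ?case by (simp add: forms_zero)
  next
    case (add c' \<beta> g)
    have "(\<lambda>x. c' * monomial_fun (\<lambda>i. \<alpha> i + \<beta> i) x + monomial_fun \<alpha> x * g x) \<in> forms (m + n)"
      using add \<open>sum \<alpha> UNIV = m\<close>
      by (intro forms_add forms_scale monomial_in_forms) (auto simp: sum.distrib)
    then show ?case by (simp add: monomial_mult[symmetric] algebra_simps)
  qed
  then have "(\<lambda>x. c * (monomial_fun \<alpha> x * g x) + f x * g x) \<in> forms (m + n)"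
    using add by (intro forms_add forms_scale)
  then show ?case by (simp add: algebra_simps)
qed

lemma forms_const: "(\<lambda>x. c) \<in> forms 0"
proof -
  have "(\<lambda>x. c * monomial_fun (\<lambda>_. 0) x) \<in> forms 0"
    by (intro forms_scale monomial_in_forms) simp
  then show ?thesis by (simp add: monomial_fun_def)
qed

lemma forms_coordinate: "(\<lambda>x. x $ i) \<in> forms 1"
proof -
  have "(\<Prod>j\<in>UNIV. (x $ j) ^ (if j = i then 1 else 0)) = x $ i" for x :: "real ^ 'a"
    by (subst prod.remove[of _ i]) (auto intro!: prod.neutral)
  then have "monomial_fun (\<lambda>j. if j = i then 1 else 0) = (\<lambda>x. x $ i)"
    by (auto simp: monomial_fun_def)
  moreover have "monomial_fun (\<lambda>j. if j = i then 1 else 0) \<in> forms 1"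
    by (rule monomial_in_forms) simp
  ultimately show ?thesis by simp
qed

lemma forms_linear: "(\<lambda>x. a \<bullet> x) \<in> forms 1"
  unfolding inner_vec_def inner_real_def by (intro forms_sum forms_scale forms_coordinate)

lemma forms_power: "f \<in> forms m \<Longrightarrow> (\<lambda>x. f x ^ j) \<in> forms (m * j)"
  by (induction j) (auto simp: forms_const intro: forms_mult)

lemma forms_prod:
  assumes "finite A" "\<And>i. i \<in> A \<Longrightarrow> f i \<in> forms (m i)"
  shows "(\<lambda>x. \<Prod>i\<in>A. f i x) \<in> forms (\<Sum>i\<in>A. m i)"
  using assms by (induction A rule: finite_induct) (auto simp: forms_const intro: forms_mult)

lemma forms_norm_sq: "(\<lambda>x. (norm x)\<^sup>2) \<in> forms 2"
proof -
  have "(\<lambda>x :: real ^ 'a. x $ i * x $ i) \<in> forms 2" for i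
    using forms_mult[OF forms_coordinate forms_coordinate, of i i] by (simp add: numeral_2_eq_2)
  then have "(\<lambda>x :: real ^ 'a. \<Sum>i\<in>UNIV. x $ i * x $ i) \<in> forms 2"
    by (intro forms_sum) auto
  then show ?thesis by (simp add: power2_norm_eq_inner inner_vec_def)
qed

lemma forms_norm_power: "(\<lambda>x. (norm x) ^ (2 * j)) \<in> forms (2 * j)"
  using forms_power[OF forms_norm_sq, of j] by (simp add: power_mult)

lemma forms_norm_mult:
  assumes "f \<in> forms (2 * j)"
  shows "(\<lambda>x. (norm x) ^ (2 * i) * f x) \<in> forms (2 * (i + j))"
  using forms_mult[OF forms_norm_power assms, of i] by simp

lemma monomial_scale: "monomial_fun \<alpha> (r *\<^sub>R x) = r ^ sum \<alpha> UNIV * monomial_fun \<alpha> x"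
  by (simp add: monomial_fun_def power_mult_distrib prod.distrib power_sum)

lemma forms_homogeneous: "f \<in> forms m \<Longrightarrow> f (r *\<^sub>R x) = r ^ m * f x"
  by (induction rule: forms_induct) (auto simp: monomial_scale algebra_simps)

lemma forms_minus: "f \<in> forms m \<Longrightarrow> f (- x) = (- 1) ^ m * f x"
  using forms_homogeneous[of f m "-1" x] by simp

lemma forms_continuous: "f \<in> forms m \<Longrightarrow> continuous_on A f"
  by (induction rule: forms_induct) (auto simp: monomial_fun_def intro!: continuous_intros)

lemma forms_compose_linear:
  fixes T :: "real ^ 'n::finite \<Rightarrow> real ^ 'n"
  assumes "linear T" "f \<in> forms m"
  shows "(\<lambda>x. f (T x)) \<in> forms m"
  using assms(2)
proof (induction rule: forms_induct)
  case zero
  then show ?case by (simp add: forms_zero)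
next
  case (add c \<alpha> g)
  have "(\<lambda>x. T x $ i) \<in> forms 1" for i
  proof -
    have "T x $ i = (adjoint T (axis i 1)) \<bullet> x" for x
      using adjoint_works[OF assms(1), of x "axis i 1"] by (simp add: inner_axis inner_commute)
    then show ?thesis using forms_linear by simp
  qed
  then have "(\<lambda>x. \<Prod>i\<in>UNIV. (T x $ i) ^ \<alpha> i) \<in> forms (\<Sum>i\<in>UNIV. 1 * \<alpha> i)"
    by (intro forms_prod forms_power) auto
  then have "(\<lambda>x. monomial_fun \<alpha> (T x)) \<in> forms m"
    using add by (simp add: monomial_fun_def)
  then show ?case using add by (intro forms_add forms_scale)
qed

text \<open>Restricting to a line turns questions about vanishing and divisibility of polynomials in
  several variables into questions about polynomials in one variable.\<close>

lemma forms_on_line: "f \<in> forms m \<Longrightarrow> \<exists>p. \<forall>b. f (x + b *\<^sub>R y) = poly p b"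
proof (induction rule: forms_induct)
  case zero
  show ?case by (rule exI[of _ 0]) simp
next
  case (add c \<alpha> g)
  then obtain p where p: "\<forall>b. g (x + b *\<^sub>R y) = poly p b" by blast
  have "monomial_fun \<alpha> (x + b *\<^sub>R y) = poly (\<Prod>i\<in>UNIV. [:x $ i, y $ i:] ^ \<alpha> i) b" for b
    by (simp add: monomial_fun_def poly_prod mult.commute)
  then show ?case using p
    by (intro exI[of _ "smult c (\<Prod>i\<in>UNIV. [:x $ i, y $ i:] ^ \<alpha> i) + p"]) simp
qed

lemma polys_add:
  assumes "f \<in> polys t" "g \<in> polys t"
  shows "(\<lambda>x. f x + g x) \<in> polys t"
proof -
  obtain c d where "f = (\<lambda>x. \<Sum>\<alpha> | sum \<alpha> UNIV \<le> t. c \<alpha> * monomial_fun \<alpha> x)"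
    "g = (\<lambda>x. \<Sum>\<alpha> | sum \<alpha> UNIV \<le> t. d \<alpha> * monomial_fun \<alpha> x)"
    using assms unfolding polys_def by blast
  then show ?thesis unfolding polys_def
    by (intro CollectI exI[of _ "\<lambda>\<alpha>. c \<alpha> + d \<alpha>"]) (simp add: algebra_simps sum.distrib)
qed

lemma polys_scale: "f \<in> polys t \<Longrightarrow> (\<lambda>x. c * f x) \<in> polys t"
  unfolding polys_def
proof (elim CollectE exE, intro CollectI)
  fix d assume "f = (\<lambda>x. \<Sum>\<alpha> | sum \<alpha> UNIV \<le> t. d \<alpha> * monomial_fun \<alpha> x)"
  then show "\<exists>e. (\<lambda>x. c * f x) = (\<lambda>x. \<Sum>\<alpha> | sum \<alpha> UNIV \<le> t. e \<alpha> * monomial_fun \<alpha> x)"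
    by (intro exI[of _ "\<lambda>\<alpha>. c * d \<alpha>"]) (simp add: sum_distrib_left mult.assoc)
qed

lemma polys_zero: "(\<lambda>x. 0) \<in> polys t"
  unfolding polys_def by (auto intro!: exI[of _ "\<lambda>_. 0"])

lemma polys_sum: "(\<And>i. i \<in> A \<Longrightarrow> f i \<in> polys t) \<Longrightarrow> (\<lambda>x. \<Sum>i\<in>A. f i x) \<in> polys t"
  by (induction A rule: infinite_finite_induct) (auto simp: polys_zero polys_add)

lemma monomial_in_polys:
  assumes "sum \<alpha> UNIV \<le> t"
  shows "monomial_fun (\<alpha> :: 'n::finite \<Rightarrow> nat) \<in> polys t"
proof -
  have "(\<Sum>\<beta> | sum \<beta> UNIV \<le> t. (if \<beta> = \<alpha> then 1 else 0) * monomial_fun \<beta> x) = monomial_fun \<alpha> x" for x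
    using assms finite_multi_indices[of t, where 'n='n]
    by (subst sum.remove[of _ \<alpha>]) (auto intro!: sum.neutral)
  then show ?thesis unfolding polys_def
    by (auto intro!: exI[of _ "\<lambda>\<beta>. if \<beta> = \<alpha> then 1 else 0"])
qed

lemma forms_subset_polys: "f \<in> forms m \<Longrightarrow> m \<le> t \<Longrightarrow> f \<in> polys t"
  by (induction rule: forms_induct)
    (auto intro!: polys_zero polys_add polys_scale monomial_in_polys)

lemma polys_decompose:
  assumes "f \<in> polys t"
  obtains h where "\<And>m. h m \<in> forms m" "f = (\<lambda>x. \<Sum>m\<le>t. h m x)"
proof -
  obtain c where c: "f = (\<lambda>x. \<Sum>\<alpha> | sum \<alpha> UNIV \<le> t. c \<alpha> * monomial_fun \<alpha> x)"
    using assms unfolding polys_def by blast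
  define h where "h m x = (\<Sum>\<alpha> | sum \<alpha> UNIV = m. c \<alpha> * monomial_fun \<alpha> x)" for m x
  have "h m \<in> forms m" for m
    unfolding h_def by (intro forms_sum forms_scale monomial_in_forms) auto
  moreover have "f x = (\<Sum>m\<le>t. h m x)" for x
  proof -
    have "(\<Sum>m\<le>t. \<Sum>\<alpha> | \<alpha> \<in> {\<alpha>. sum \<alpha> UNIV \<le> t} \<and> sum \<alpha> UNIV = m. c \<alpha> * monomial_fun \<alpha> x)
        = (\<Sum>\<alpha> | sum \<alpha> UNIV \<le> t. c \<alpha> * monomial_fun \<alpha> x)"
      by (intro sum.group finite_multi_indices) auto
    moreover have "(\<Sum>m\<le>t. \<Sum>\<alpha> | \<alpha> \<in> {\<alpha>. sum \<alpha> UNIV \<le> t} \<and> sum \<alpha> UNIV = m. c \<alpha> * monomial_fun \<alpha> x)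
        = (\<Sum>m\<le>t. h m x)"
      unfolding h_def by (intro sum.cong refl) auto
    ultimately show ?thesis by (simp add: c)
  qed
  ultimately show ?thesis using that by blast
qed

lemma polys_mult_form:
  assumes "f \<in> polys s" "g \<in> forms m" "s + m \<le> t"
  shows "(\<lambda>x. f x * g x) \<in> polys t"
proof -
  obtain h where h: "\<And>i. h i \<in> forms i" "f = (\<lambda>x. \<Sum>i\<le>s. h i x)"
    using polys_decompose[OF assms(1)] by metis
  have "(\<lambda>x. \<Sum>i\<le>s. h i x * g x) \<in> polys t"
    using assms by (intro polys_sum forms_subset_polys[OF forms_mult[OF h(1)]]) auto
  then show ?thesis by (simp add: h(2) sum_distrib_right)
qed

lemma polys_mult:
  assumes "f \<in> polys s" "g \<in> polys t" "s + t \<le> u"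
  shows "(\<lambda>x. f x * g x) \<in> polys u"
proof -
  obtain h where h: "\<And>i. h i \<in> forms i" "g = (\<lambda>x. \<Sum>i\<le>t. h i x)"
    using polys_decompose[OF assms(2)] by metis
  have "(\<lambda>x. \<Sum>i\<le>t. f x * h i x) \<in> polys u"
    using assms by (intro polys_sum polys_mult_form[OF assms(1) h(1)]) auto
  then show ?thesis by (simp add: h(2) sum_distrib_left)
qed

lemma polys_on_line:
  assumes "f \<in> polys t"
  shows "\<exists>p. \<forall>b. f (x + b *\<^sub>R y) = poly p b"
proof -
  obtain h where h: "\<And>i. h i \<in> forms i" "f = (\<lambda>x. \<Sum>i\<le>t. h i x)"
    using polys_decompose[OF assms] by metis
  have "\<forall>i. \<exists>p. \<forall>b. h i (x + b *\<^sub>R y) = poly p b"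
    using forms_on_line[OF h(1)] by blast
  then obtain p where "\<forall>i b. h i (x + b *\<^sub>R y) = poly (p i) b" by metis
  then show ?thesis
    by (intro exI[of _ "\<Sum>i\<le>t. p i"]) (simp add: h(2) poly_sum)
qed

definition even_polys :: "nat \<Rightarrow> (real ^ 'n::finite \<Rightarrow> real) set" where
  "even_polys t = {f \<in> polys t. \<forall>x. f (- x) = f x}"

text \<open>Averaging over \<open>x\<close> and \<open>- x\<close> removes the components of odd degree.\<close>

lemma even_polys_decompose:
  assumes "f \<in> even_polys (2 * k)"
  obtains h where "\<And>j. h j \<in> forms (2 * j)" "f = (\<lambda>x. \<Sum>j\<le>k. h j x)"
proof -
  obtain h where h: "\<And>i. h i \<in> forms i" "f = (\<lambda>x. \<Sum>i\<le>2 * k. h i x)"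
    using assms polys_decompose unfolding even_polys_def by blast
  have "f x = (\<Sum>j\<le>k. h (2 * j) x)" for x
  proof -
    have "2 * f x = f x + f (- x)" using assms by (simp add: even_polys_def)
    also have "\<dots> = (\<Sum>i\<le>2 * k. h i x + (- 1) ^ i * h i x)"
      using forms_minus[OF h(1)] by (simp add: h(2) sum.distrib)
    also have "\<dots> = (\<Sum>i\<in>{i. i \<le> 2 * k \<and> even i}. 2 * h i x)"
      by (rule sum.mono_neutral_cong_right) auto
    also have "{i. i \<le> 2 * k \<and> even i} = (\<lambda>j. 2 * j) ` {..k}"
      by (auto elim!: evenE)
    also have "(\<Sum>i\<in>(\<lambda>j. 2 * j) ` {..k}. 2 * h i x) = 2 * (\<Sum>j\<le>k. h (2 * j) x)"
      by (simp add: sum.reindex inj_on_def sum_distrib_left)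
    finally show ?thesis by simp
  qed
  then show ?thesis using that[of "\<lambda>j. h (2 * j)"] h(1) by auto
qed

lemma forms_in_even_polys: "f \<in> forms (2 * j) \<Longrightarrow> 2 * j \<le> t \<Longrightarrow> f \<in> even_polys t"
  by (auto simp: even_polys_def forms_subset_polys forms_minus)

lemma even_polys_add: "f \<in> even_polys t \<Longrightarrow> g \<in> even_polys t \<Longrightarrow> (\<lambda>x. f x + g x) \<in> even_polys t"
  by (auto simp: even_polys_def polys_add)

lemma even_polys_scale: "f \<in> even_polys t \<Longrightarrow> (\<lambda>x. c * f x) \<in> even_polys t"
  by (auto simp: even_polys_def polys_scale)

lemma even_polys_sum:
  "(\<And>i. i \<in> A \<Longrightarrow> f i \<in> even_polys t) \<Longrightarrow> (\<lambda>x. \<Sum>i\<in>A. f i x) \<in> even_polys t"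
  by (auto simp: even_polys_def polys_sum)

lemma subspace_even_polys: "fun_space.subspace (even_polys t)"
  unfolding fun_space.subspace_def plus_fun_def
  by (auto intro: even_polys_add even_polys_scale) (simp add: zero_fun_def even_polys_def polys_zero)

lemma forms_vanishing:
  assumes "f \<in> forms m" "\<And>x. norm x = 1 \<Longrightarrow> f x = 0"
  shows "f x = 0"
proof (cases "x = 0")
  case False
  then have "f x = norm x ^ m * f (sgn x)"
    using forms_homogeneous[OF assms(1), of "norm x" "sgn x"] by (simp add: sgn_div_norm)
  then show ?thesis using False assms(2) by (simp add: norm_sgn)
next
  case True
  have "f (0 *\<^sub>R axis undefined 1) = 0 ^ m * f (axis undefined 1)"
    by (rule forms_homogeneous[OF assms(1)])
  then show ?thesis using True assms(2)[of "axis undefined 1"] by simp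
qed

lemma polys_vanishing_Omega:
  fixes f :: "real ^ 'n::finite \<Rightarrow> real"
  assumes "f \<in> polys t" "\<And>x. x \<in> Omega \<Longrightarrow> f x = 0"
  shows "f x = 0"
proof -
  define e where "e = (axis undefined 1 :: real ^ 'n)"
  have e: "norm e = 1" by (simp add: e_def)
  obtain p where p: "\<forall>b. f (x + b *\<^sub>R e) = poly p b"
    using polys_on_line[OF assms(1)] by blast
  have "poly p b = 0" if "b \<ge> norm x + 1" for b
  proof -
    have "norm (x + b *\<^sub>R e) \<ge> norm (b *\<^sub>R e) - norm x"
      using norm_triangle_ineq4[of "x + b *\<^sub>R e" x] by simp
    also have "norm (b *\<^sub>R e) = \<bar>b\<bar>" using e by simp
    finally have "norm (x + b *\<^sub>R e) \<ge> 1" using that by linarith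
    then show ?thesis using assms(2)[of "x + b *\<^sub>R e"] p[rule_format, of b]
      unfolding Omega_def by simp
  qed
  then have "{norm x + 1..} \<subseteq> {b. poly p b = 0}" by auto
  then have "p = 0"
    using infinite_Ici[of "norm x + 1"] poly_roots_finite[of p] finite_subset by blast
  then show ?thesis using p[rule_format, of 0] by simp
qed

text \<open>If the squared norm divided the form \<open>x\<^sub>i\<^sup>4\<close>, then on a line parallel to a second coordinate
  axis the polynomial \<open>1 + b\<^sup>2\<close> would divide \<open>1\<close>.\<close>

lemma quartic_not_multiple_of_norm:
  assumes "CARD('n::finite) \<ge> 2"
  shows "\<exists>f \<in> forms 4. \<forall>g \<in> forms 2. f \<noteq> (\<lambda>x :: real ^ 'n. (norm x)\<^sup>2 * g x)"
proof -
  obtain i j :: 'n where ij: "i \<noteq> j"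
    using assms card_le_Suc0_iff_eq[of "UNIV :: 'n set"] by force
  define f where "f x = (x $ i) ^ 4" for x :: "real ^ 'n"
  have "f \<in> forms 4"
    using forms_power[OF forms_coordinate, of i 4] by (simp add: f_def[abs_def])
  moreover have False if g: "g \<in> forms 2" "f = (\<lambda>x. (norm x)\<^sup>2 * g x)" for g
  proof -
    define x y where "x = (axis i 1 :: real ^ 'n)" and "y = (axis j 1 :: real ^ 'n)"
    obtain p where p: "\<forall>b. g (x + b *\<^sub>R y) = poly p b"
      using forms_on_line[OF g(1)] by blast
    have "poly ([:1, 0, 1:] * p) b = poly 1 b" for b
    proof -
      have "f (x + b *\<^sub>R y) = 1" using ij by (simp add: f_def x_def y_def axis_def)
      moreover have "(norm (x + b *\<^sub>R y))\<^sup>2 = 1 + b\<^sup>2"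
        using ij unfolding power2_norm_eq_inner inner_add_left inner_add_right
        by (simp add: x_def y_def inner_axis_axis power2_eq_square)
      ultimately have "1 = (1 + b\<^sup>2) * poly p b" using g(2) p by metis
      then show ?thesis by (simp add: algebra_simps power2_eq_square)
    qed
    then have eq: "[:1, 0, 1:] * p = 1" using poly_eq_poly_eq_iff by blast
    then have "[:1, 0, 1 :: real:] dvd 1" by (metis dvd_triv_left)
    then show False by (auto simp: is_unit_poly_iff)
  qed
  ultimately show ?thesis by blast
qed

section \<open>The surface measure\<close>

text \<open>This is the uniqueness proof for translation-invariant measures. Let \<open>\<lambda>\<close> be Lebesgue measure and
  \<open>A\<close> the unit ball, which is preserved by \<open>T\<close> and by negation. By translation invariance the double
  integral of \<open>1\<^sub>B (T y) * 1\<^sub>A (T y - x)\<close> over \<open>x\<close> and \<open>y\<close> equals \<open>\<lambda> A * \<lambda> (T -` B)\<close> in one order of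
  integration and \<open>\<lambda> A * \<lambda> B\<close> in the other.\<close>

lemma lborel_distr_orthogonal:
  fixes T :: "'a::euclidean_space \<Rightarrow> 'a"
  assumes T: "orthogonal_transformation T"
  shows "distr lborel borel T = lborel"
proof -
  have lin: "linear T" using T by (rule orthogonal_transformation_linear)
  have cont: "continuous_on UNIV T" using lin by (intro linear_continuous_on) (simp add: linear_conv_bounded_linear)
  have [measurable]: "T \<in> borel_measurable borel" using cont by (rule borel_measurable_continuous_onI)
  define A where "A = (ball 0 1 :: 'a set)"
  have [measurable]: "A \<in> sets borel" by (simp add: A_def)
  have "surj T" using T by (rule orthogonal_transformation_surj)
  have TA: "T y \<in> A \<longleftrightarrow> y \<in> A" for y
    using orthogonal_transformation_norm[OF T] by (simp add: A_def)
  have A_uminus: "- x \<in> A \<longleftrightarrow> x \<in> A" for x by (simp add: A_def)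
  have A_pos: "emeasure lborel A \<noteq> 0" "emeasure lborel A \<noteq> \<infinity>"
    using emeasure_lborel_ball_finite[of "0::'a" 1] content_ball_pos[of 1 "0::'a"]
    by (auto simp: A_def measure_def)
  have transl: "(\<integral>\<^sup>+x. g (c + x) \<partial>lborel) = (\<integral>\<^sup>+x. g x \<partial>lborel)"
    if [measurable]: "g \<in> borel_measurable borel" for g :: "'a \<Rightarrow> ennreal" and c
  proof -
    have "(\<integral>\<^sup>+x. g x \<partial>lborel) = (\<integral>\<^sup>+x. g x \<partial>distr lborel borel ((+) c))"
      by (simp add: lborel_distr_plus)
    also have "\<dots> = (\<integral>\<^sup>+x. g (c + x) \<partial>lborel)"
      by (subst nn_integral_distr) auto
    finally show ?thesis by simp
  qed
  have key: "emeasure lborel A * emeasure lborel (T -` B) = emeasure lborel A * emeasure lborel B"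
    if [measurable]: "B \<in> sets borel" for B
  proof -
    define F where "F x y = (indicator B (T y) * indicator A (T y - x) :: ennreal)" for x y
    have [measurable]: "(\<lambda>(x, y). F x y) \<in> borel_measurable (borel \<Otimes>\<^sub>M borel)"
      unfolding F_def by measurable
    have "(\<integral>\<^sup>+x. F x y \<partial>lborel) = indicator B (T y) * emeasure lborel A" for y
    proof -
      have "(\<integral>\<^sup>+x. F x y \<partial>lborel) = (\<integral>\<^sup>+x. F (T y + x) y \<partial>lborel)"
        by (rule transl[symmetric]) (unfold F_def, measurable)
      also have "\<dots> = (\<integral>\<^sup>+x. indicator B (T y) * indicator A x \<partial>lborel)"
        by (simp add: F_def indicator_def A_uminus)
      finally show ?thesis by (simp add: nn_integral_cmult)
    qed
    moreover have "(\<integral>\<^sup>+y. F x y \<partial>lborel) = (\<integral>\<^sup>+y. indicator B (x + T y) * indicator A y \<partial>lborel)" for x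
    proof -
      obtain c where c: "T c = x" using \<open>surj T\<close> by (metis surjD)
      have "(\<integral>\<^sup>+y. F x y \<partial>lborel) = (\<integral>\<^sup>+y. F x (c + y) \<partial>lborel)"
        by (rule transl[symmetric]) (unfold F_def, measurable)
      then show ?thesis by (simp add: F_def linear_add[OF lin] c indicator_def TA)
    qed
    moreover have "(\<integral>\<^sup>+x. indicator B (x + T y) * indicator A y \<partial>lborel) = emeasure lborel B * indicator A y" for y
    proof -
      have "(\<integral>\<^sup>+x. indicator B (T y + x) * indicator A y \<partial>lborel) = (\<integral>\<^sup>+x. indicator B x * indicator A y \<partial>lborel)"
        by (rule transl) measurable
      then show ?thesis by (simp add: add.commute nn_integral_multc)
    qed
    moreover have "(\<integral>\<^sup>+y. (\<integral>\<^sup>+x. F x y \<partial>lborel) \<partial>lborel) = (\<integral>\<^sup>+x. (\<integral>\<^sup>+y. F x y \<partial>lborel) \<partial>lborel)"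
      by (rule lborel_pair.Fubini') simp
    moreover have "(\<integral>\<^sup>+y. (\<integral>\<^sup>+x. indicator B (x + T y) * indicator A y \<partial>lborel) \<partial>lborel)
        = (\<integral>\<^sup>+x. (\<integral>\<^sup>+y. indicator B (x + T y) * indicator A y \<partial>lborel) \<partial>lborel)"
      by (rule lborel_pair.Fubini') measurable
    moreover have "(\<integral>\<^sup>+y. indicator B (T y) * emeasure lborel A \<partial>lborel) = emeasure lborel A * emeasure lborel (T -` B)"
    proof -
      have [measurable]: "T -` B \<in> sets borel"
        using measurable_sets_borel[of T borel B] by simp
      have "(\<integral>\<^sup>+y. indicator B (T y) * emeasure lborel A \<partial>lborel)
        = (\<integral>\<^sup>+y. emeasure lborel A * indicator (T -` B) y \<partial>lborel)"
        by (intro nn_integral_cong) (auto simp: indicator_def)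
      then show ?thesis by (simp add: nn_integral_cmult)
    qed
    moreover have "(\<integral>\<^sup>+y. emeasure lborel B * indicator A y \<partial>lborel) = emeasure lborel A * emeasure lborel B"
      by (simp add: nn_integral_cmult, simp add: mult.commute)
    ultimately show ?thesis by simp
  qed
  show ?thesis
  proof (rule measure_eqI)
    fix B assume "B \<in> sets (distr lborel borel T)"
    then have B: "B \<in> sets borel" by simp
    then have "emeasure lborel (T -` B) = emeasure lborel B"
      using key[OF B] A_pos by (simp add: ennreal_mult_cancel_left)
    then show "emeasure (distr lborel borel T) B = emeasure lborel B"
      using B by (simp add: emeasure_distr)
  qed simp
qed

definition sphere_integral :: "(real ^ 'n::finite \<Rightarrow> real) \<Rightarrow> real" where
  "sphere_integral f = (LINT x|sphere_measure. f x)"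

context
  fixes f :: "real ^ 'n::finite \<Rightarrow> real"
  assumes f: "continuous_on UNIV f"
begin

lemma integrable_on_cone:
  "integrable lborel (\<lambda>y. indicator (ball 0 1 - {0}) y * f (sgn y))"
proof -
  have [measurable]: "f \<in> borel_measurable borel" using f by (rule borel_measurable_continuous_onI)
  have [measurable]: "(sgn :: real ^ 'n \<Rightarrow> _) \<in> borel_measurable borel"
  proof -
    have "(\<lambda>x :: real ^ 'n. inverse (norm x) *\<^sub>R x) \<in> borel_measurable borel" by measurable
    then show ?thesis by (simp add: sgn_div_norm)
  qed
  have "compact (f ` sphere 0 1)"
    by (intro compact_continuous_image continuous_on_subset[OF f]) auto
  then obtain B where B: "\<And>x. x \<in> sphere 0 1 \<Longrightarrow> \<bar>f x\<bar> \<le> B"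
    using compact_imp_bounded bounded_iff by (metis imageI real_norm_def)
  have fin: "emeasure lborel (ball 0 1 - {0 :: real ^ 'n}) < \<infinity>"
    by (rule le_less_trans[OF emeasure_mono emeasure_lborel_ball_finite[of "0 :: real ^ 'n" 1]]) auto
  have "integrable lborel (\<lambda>y. indicator (ball 0 1 - {0}) y *\<^sub>R f (sgn y))"
  proof (rule integrableI_bounded_set_indicator[where B = B])
    show "AE y in lborel. y \<in> ball 0 1 - {0} \<longrightarrow> norm (f (sgn y)) \<le> B"
      by (rule AE_I2) (simp add: B norm_sgn)
  qed (use fin in auto)
  then show ?thesis by simp
qed

lemma sphere_integral_cone:
  "sphere_integral f = CARD('n) * (LINT y|lborel. indicator (ball 0 1 - {0}) y * f (sgn y))"
proof -
  have scale: "scale_measure c M = density M (\<lambda>_. c)" for c and M :: "(real ^ 'n) measure"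
    by (rule measure_eqI) (auto simp: emeasure_density_const)
  have [measurable]: "f \<in> borel_measurable (restrict_space borel (sphere 0 1))"
    using f by (intro measurable_restrict_space1 borel_measurable_continuous_onI)
  have "sphere_integral f = integral\<^sup>L (density
      (distr (restrict_space lborel (ball 0 1 - {0})) (restrict_space borel (sphere 0 1)) sgn)
      (\<lambda>_. ennreal (real CARD('n)))) f"
    by (simp add: sphere_integral_def sphere_measure_def scale ennreal_of_nat_eq_real_of_nat)
  also have "\<dots> = CARD('n) * integral\<^sup>L
      (distr (restrict_space lborel (ball 0 1 - {0})) (restrict_space borel (sphere 0 1)) sgn) f"
    by (subst integral_density) auto
  also have "integral\<^sup>L (distr (restrict_space lborel (ball 0 1 - {0}))
      (restrict_space borel (sphere 0 1)) sgn) f =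
      integral\<^sup>L (restrict_space lborel (ball 0 1 - {0})) (\<lambda>y. f (sgn y))"
    by (intro integral_distr measurable_sgn_sphere) auto
  also have "\<dots> = (LINT y|lborel. indicator (ball 0 1 - {0}) y * f (sgn y))"
    by (subst integral_restrict_space) auto
  finally show ?thesis .
qed

end

lemma sphere_integral_scale: "sphere_integral (\<lambda>x. c * f x) = c * sphere_integral f"
  by (simp add: sphere_integral_def)

lemma sphere_integral_add:
  assumes "continuous_on UNIV f" "continuous_on UNIV g"
  shows "sphere_integral (\<lambda>x. f x + g x) = sphere_integral f + sphere_integral g"
proof -
  have "(LINT y|lborel. indicator (ball 0 1 - {0}) y * (f (sgn y) + g (sgn y))) =
    (LINT y|lborel. indicator (ball 0 1 - {0}) y * f (sgn y)) +
    (LINT y|lborel. indicator (ball 0 1 - {0}) y * g (sgn y))"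
    using Bochner_Integration.integral_add[OF integrable_on_cone[OF assms(1)] integrable_on_cone[OF assms(2)]]
    by (simp add: distrib_left)
  then show ?thesis
    using assms by (simp add: sphere_integral_cone continuous_on_add distrib_left)
qed

lemma sphere_integral_cong:
  assumes "continuous_on UNIV f" "continuous_on UNIV g" "\<And>x. norm x = 1 \<Longrightarrow> f x = g x"
  shows "sphere_integral f = sphere_integral g"
proof -
  have "indicator (ball 0 1 - {0}) y * f (sgn y) = indicator (ball 0 1 - {0}) y * g (sgn y)" for y
    using assms(3)[of "sgn y"] by (cases "y = 0") (auto simp: indicator_def norm_sgn)
  then show ?thesis
    by (simp only: sphere_integral_cone[OF assms(1)] sphere_integral_cone[OF assms(2)])
qed

lemma sphere_integral_orthogonal:
  fixes f :: "real ^ 'n::finite \<Rightarrow> real" and T :: "real ^ 'n \<Rightarrow> real ^ 'n"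
  assumes f: "continuous_on UNIV f" and T: "orthogonal_transformation T"
  shows "sphere_integral (\<lambda>x. f (T x)) = sphere_integral f"
proof -
  have lin: "linear T" using T by (rule orthogonal_transformation_linear)
  have cont: "continuous_on UNIV T" using lin by (intro linear_continuous_on) (simp add: linear_conv_bounded_linear)
  have fT: "continuous_on UNIV (\<lambda>x. f (T x))"
    by (rule continuous_on_compose2[OF f cont]) auto
  define g where "g y = indicator (ball 0 1 - {0}) y * f (sgn y)" for y
  have "g (T y) = indicator (ball 0 1 - {0}) y * f (T (sgn y))" for y
  proof -
    have n: "norm (T y) = norm y" using orthogonal_transformation_norm[OF T] .
    then have "T y = 0 \<longleftrightarrow> y = 0" by (metis norm_eq_zero)
    then have "indicator (ball 0 1 - {0}) (T y) = (indicator (ball 0 1 - {0}) y :: real)"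
      using n by (simp add: indicator_def)
    moreover have "sgn (T y) = T (sgn y)"
      unfolding sgn_div_norm n by (rule linear_scale[OF lin, symmetric])
    ultimately show ?thesis by (simp only: g_def)
  qed
  then have "sphere_integral (\<lambda>x. f (T x)) = CARD('n) * (LINT y|lborel. g (T y))"
    using sphere_integral_cone[OF fT] by simp
  also have "(LINT y|lborel. g (T y)) = integral\<^sup>L (distr lborel borel T) g"
    using integrable_on_cone[OF f] cont
    by (subst integral_distr) (auto simp: g_def[abs_def] intro: borel_measurable_continuous_onI)
  also have "\<dots> = integral\<^sup>L lborel g" by (simp add: lborel_distr_orthogonal[OF T])
  finally show ?thesis using sphere_integral_cone[OF f] by (simp add: g_def[abs_def])
qed

lemma sphere_integral_odd:
  fixes f :: "real ^ 'n::finite \<Rightarrow> real"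
  assumes "continuous_on UNIV f" "\<And>x. f (- x) = - f x"
  shows "sphere_integral f = 0"
proof -
  have "orthogonal_transformation (\<lambda>x :: real ^ 'n. - x)"
    unfolding orthogonal_transformation_def by (auto intro: linearI)
  from sphere_integral_orthogonal[OF assms(1) this] have "sphere_integral f = sphere_integral (\<lambda>x. - 1 * f x)"
    by (simp add: assms(2))
  then show ?thesis unfolding sphere_integral_scale by simp
qed

lemma sphere_integral_nonneg: "(\<And>x. f x \<ge> 0) \<Longrightarrow> sphere_integral f \<ge> 0"
  by (simp add: sphere_integral_def)

text \<open>If \<open>f\<close> were positive at a point of the sphere, then it would be positive along a whole open set of
  directions, and the cone over that set has positive Lebesgue measure.\<close>

lemma sphere_integral_eq_0:
  fixes f :: "real ^ 'n::finite \<Rightarrow> real"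
  assumes f: "continuous_on UNIV f" "\<And>x. f x \<ge> 0" and 0: "sphere_integral f = 0" and x: "norm x = 1"
  shows "f x = 0"
proof (rule ccontr)
  assume "f x \<noteq> 0"
  define g where "g y = indicator (ball 0 1 - {0}) y * f (sgn y)" for y :: "real ^ 'n"
  define S where "S = ball 0 1 - {0 :: real ^ 'n}"
  have "integral\<^sup>L lborel g = 0" using 0 sphere_integral_cone[OF f(1)] by (simp add: g_def[abs_def])
  moreover have "integrable lborel g" using integrable_on_cone[OF f(1)] by (simp add: g_def[abs_def])
  moreover have "AE y in lborel. 0 \<le> g y" using f(2) by (simp add: g_def)
  ultimately have ae: "AE y in lborel. g y = 0" by (simp add: integral_nonneg_eq_0_iff_AE)
  have "open S" by (simp add: S_def open_delete)
  moreover have "continuous_on S (\<lambda>y. f (sgn y))"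
    by (rule continuous_on_compose2[OF f(1)])
      (auto simp: S_def sgn_div_norm intro!: continuous_intros)
  ultimately have "open (S \<inter> (\<lambda>y. f (sgn y)) -` (- {0}))"
    by (intro continuous_open_preimage) auto
  moreover have "(1/2) *\<^sub>R x \<in> S \<inter> (\<lambda>y. f (sgn y)) -` (- {0})"
    using x \<open>f x \<noteq> 0\<close> by (auto simp: S_def sgn_div_norm)
  moreover have "S \<inter> (\<lambda>y. f (sgn y)) -` (- {0}) \<subseteq> {y. g y \<noteq> 0}"
    by (auto simp: g_def S_def)
  ultimately obtain U where U: "open U" "U \<noteq> {}" "U \<subseteq> {y. g y \<noteq> 0}" by blast
  have "AE y in lborel. y \<notin> U" using ae U(3) by auto
  then have "U \<in> null_sets lborel" using U(1) by (simp add: AE_iff_null_sets)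
  then have "negligible U" by (simp add: negligible_iff_null_sets null_sets_completionI)
  then show False using U open_not_negligible by blast
qed

section \<open>The radial weight and its orthogonal polynomials\<close>

definition radial_moment :: "nat \<Rightarrow> real" where
  "radial_moment n = (LINT r:{1..}|lborel. sqrt (r\<^sup>2 - 1) / r ^ (2 * n + 3))"

text \<open>For a polynomial \<open>p\<close> in \<open>s = 1 / r\<^sup>2\<close> this is the integral of \<open>p\<close> against the radial weight, carried
  to \<open>[0, 1]\<close> and parametrized by \<open>s = (cos t)\<^sup>2\<close>.\<close>

definition radial :: "real poly \<Rightarrow> real" where
  "radial p = integral {0..pi/2} (\<lambda>t. poly p ((cos t)\<^sup>2) * (sin t)\<^sup>2)"

text \<open>The substitution is \<open>r = 1 / cos t\<close>.\<close>

lemma radial_moment_eq: "radial_moment n = radial (monom 1 n)"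
proof -
  define f where "f r = sqrt (r\<^sup>2 - 1) / r ^ (2 * n + 3)" for r :: real
  define g g' where "g t = 1 / cos t" and "g' t = sin t / (cos t)\<^sup>2" for t :: real
  define h where "h t = poly (monom 1 n) ((cos t)\<^sup>2) * (sin t)\<^sup>2" for t :: real
  have cos_pos: "cos t > 0" if "0 < t" "t < pi / 2" for t
    using that by (intro cos_gt_zero_pi) auto
  have sin_pos: "sin t > 0" if "0 < t" "t < pi / 2" for t
    using that by (intro sin_gt_zero) auto
  have fg: "f (g t) * g' t = h t" if t: "0 < t" "t < pi / 2" for t
  proof -
    note c = cos_pos[OF t] and s = sin_pos[OF t]
    have "(g t)\<^sup>2 - 1 = (sin t / cos t)\<^sup>2"
      using c by (simp add: g_def power_divide field_simps sin_squared_eq)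
    then have "sqrt ((g t)\<^sup>2 - 1) = sin t / cos t" using c s by simp
    then have "f (g t) * g' t = (sin t / cos t) * cos t ^ (2 * n + 3) * (sin t / (cos t)\<^sup>2)"
      by (simp add: f_def g_def g'_def power_divide)
    also have "cos t ^ (2 * n + 3) = ((cos t)\<^sup>2) ^ n * cos t ^ 3"
      by (simp add: power_add power_mult)
    finally show ?thesis using c
      by (simp add: h_def poly_monom power2_eq_square power3_eq_cube)
  qed
  have cont_h: "continuous_on {0..pi/2} h"
    unfolding h_def by (intro continuous_intros)
  then have int_h: "set_integrable lborel {0..pi/2} h"
    by (rule borel_integrable_atLeastAtMost')
  have einterval: "einterval 0 (ereal (pi / 2)) = {0<..<pi/2}"
    by (auto simp: einterval_def)
  have "(LBINT x=1..\<infinity>. f x) = (LBINT t=0..ereal (pi/2). f (g t) * g' t)"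
  proof (rule interval_integral_substitution_nonneg(2))
    show "0 < ereal (pi / 2)" by simp
    show "DERIV g t :> g' t" if "0 < ereal t" "ereal t < ereal (pi / 2)" for t
      unfolding g_def g'_def using cos_pos[of t] that
      by (auto intro!: derivative_eq_intros simp: power2_eq_square)
    show "isCont f (g t)" if "0 < ereal t" "ereal t < ereal (pi / 2)" for t
      unfolding f_def using cos_pos[of t] that
      by (intro continuous_intros) (auto simp: g_def)
    show "isCont g' t" if "0 < ereal t" "ereal t < ereal (pi / 2)" for t
      unfolding g'_def using cos_pos[of t] that by (intro continuous_intros) auto
    show "0 \<le> f (g t)" if "0 < ereal t" "ereal t < ereal (pi / 2)" for t
    proof -
      have "0 < cos t" "cos t \<le> 1" using cos_pos[of t] that by auto
      then have "1 \<le> g t" by (simp add: g_def)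
      then show ?thesis by (simp add: f_def)
    qed
    show "0 \<le> g' t" if "0 \<le> ereal t" "ereal t \<le> ereal (pi / 2)" for t
      unfolding g'_def using that by (intro divide_nonneg_nonneg sin_ge_zero) auto
    have "((\<lambda>t. 1 / cos t) \<longlongrightarrow> 1 / cos 0) (at_right (0 :: real))"
      by (intro tendsto_intros) auto
    then show "((ereal \<circ> g \<circ> real_of_ereal) \<longlongrightarrow> 1) (at_right 0)"
      unfolding ereal_tendsto_simps zero_ereal_def one_ereal_def by (simp add: g_def[abs_def])
    have "filterlim (\<lambda>t. cos t) (at_right 0) (at_left (pi / 2))"
      unfolding filterlim_at
    proof
      show "((\<lambda>t. cos t) \<longlongrightarrow> 0) (at_left (pi / 2))"
        using tendsto_cos[OF tendsto_ident_at, of "pi/2" "{..<pi/2}"] by simp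
      have "eventually (\<lambda>t. t \<in> {0<..<pi/2}) (at_left (pi/2))"
        by (rule eventually_at_leftI[of 0]) auto
      then show "\<forall>\<^sub>F t in at_left (pi / 2). cos t \<in> {0<..} \<and> cos t \<noteq> 0"
        by eventually_elim (use cos_pos in fastforce)
    qed
    then have "filterlim (\<lambda>t. inverse (cos t)) at_top (at_left (pi / 2))"
      by (rule filterlim_compose[OF filterlim_inverse_at_top_right])
    then show "((ereal \<circ> g \<circ> real_of_ereal) \<longlongrightarrow> \<infinity>) (at_left (ereal (pi / 2)))"
      unfolding ereal_tendsto_simps by (simp add: g_def[abs_def] inverse_eq_divide)
    have "set_integrable lborel {0<..<pi/2} h"
      by (rule set_integrable_subset[OF int_h]) auto
    then show "set_integrable lborel (einterval 0 (ereal (pi / 2))) (\<lambda>t. f (g t) * g' t)"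
      unfolding einterval by (rule set_integrable_cong[THEN iffD1, rotated -1]) (auto simp: fg)
  qed
  also have "(LBINT x=1..\<infinity>. f x) = (LINT x:{1<..}|lborel. f x)"
    using interval_integral_to_infinity_eq[of lborel 1 f] by (simp add: one_ereal_def)
  also have "(LINT x:{1<..}|lborel. f x) = (LINT x:{1..}|lborel. f x)"
    by (rule set_integral_discrete_difference[where X = "{1}"]) auto
  also have "(LBINT t=0..ereal (pi/2). f (g t) * g' t) = (LBINT t=0..ereal (pi/2). h t)"
    by (rule interval_integral_cong) (auto simp: fg einterval_def)
  also have "\<dots> = integral {0..pi/2} h"
    using interval_integral_eq_integral[of 0 "pi/2" h] int_h by (simp add: zero_ereal_def)
  finally show ?thesis by (simp add: radial_moment_def radial_def f_def[abs_def] h_def[abs_def])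
qed

lemma radial_integrable: "(\<lambda>t. poly p ((cos t)\<^sup>2) * (sin t)\<^sup>2) integrable_on {0..pi/2}"
  by (intro integrable_continuous_interval continuous_intros)

lemma radial_add: "radial (p + q) = radial p + radial q"
  using Henstock_Kurzweil_Integration.integral_add[OF radial_integrable radial_integrable, of p q]
  by (simp add: radial_def algebra_simps)

lemma radial_smult: "radial (smult c p) = c * radial p"
  by (simp add: radial_def mult.assoc)

lemma radial_0: "radial 0 = 0"
  by (simp add: radial_def)

lemma radial_sum: "radial (\<Sum>i\<in>A. f i) = (\<Sum>i\<in>A. radial (f i))"
  by (induction A rule: infinite_finite_induct) (auto simp: radial_0 radial_add)

text \<open>These are the Chebyshev polynomials of the fourth kind, transported from \<open>[-1, 1]\<close> to \<open>[0, 1]\<close>; at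
  \<open>(cos t)\<^sup>2\<close> they are quotients of sines. So their orthogonality for the radial weight is that of the
  functions \<open>sin ((2 * n + 1) * t)\<close> on \<open>[0, \<pi> / 2]\<close>.\<close>

fun cheb :: "nat \<Rightarrow> real poly" where
  "cheb 0 = 1"
| "cheb (Suc 0) = [:-1, 4:]"
| "cheb (Suc (Suc n)) = [:-2, 4:] * cheb (Suc n) - cheb n"

lemma cheb_trig: "poly (cheb n) ((cos t)\<^sup>2) * sin t = sin ((2 * real n + 1) * t)"
proof (induction n rule: cheb.induct)
  case 1
  then show ?case by simp
next
  case 2
  have "sin (3 * t) = sin (2 * t + t)" by (simp add: algebra_simps)
  also have "\<dots> = (4 * (cos t)\<^sup>2 - 1) * sin t"
    unfolding sin_add sin_double cos_double_cos by (simp add: algebra_simps power2_eq_square)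
  finally show ?case by (simp add: algebra_simps)
next
  case (3 n)
  have e1: "sin ((2 * real (Suc (Suc n)) + 1) * t) = sin ((2 * real (Suc n) + 1) * t + 2 * t)"
    and e2: "sin ((2 * real n + 1) * t) = sin ((2 * real (Suc n) + 1) * t - 2 * t)"
    by (simp_all add: algebra_simps)
  have "sin ((2 * real (Suc (Suc n)) + 1) * t) + sin ((2 * real n + 1) * t)
      = sin ((2 * real (Suc n) + 1) * t) * (2 * cos (2 * t))"
    unfolding e1 e2 sin_add sin_diff by simp
  then have "sin ((2 * real (Suc (Suc n)) + 1) * t)
      = (4 * (cos t)\<^sup>2 - 2) * sin ((2 * real (Suc n) + 1) * t) - sin ((2 * real n + 1) * t)"
    unfolding cos_double_cos[of t] by (simp add: algebra_simps)
  also have "\<dots> = poly (cheb (Suc (Suc n))) ((cos t)\<^sup>2) * sin t"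
    unfolding 3[symmetric] by (simp add: algebra_simps)
  finally show ?case ..
qed

lemma degree_cheb_le: "degree (cheb n) \<le> n"
proof (induction n rule: cheb.induct)
  case (3 n)
  have "degree ([:-2, 4:] * cheb (Suc n)) \<le> Suc (Suc n)"
    using degree_mult_le[of "[:-2, 4:]" "cheb (Suc n)"] 3(1) by auto
  then show ?case using 3(2) by (auto intro!: degree_diff_le)
qed auto

lemma coeff_cheb: "coeff (cheb n) n = 4 ^ n"
proof (induction n rule: cheb.induct)
  case (3 n)
  have "coeff (cheb n) (Suc (Suc n)) = 0" "coeff (cheb (Suc n)) (Suc (Suc n)) = 0"
    using degree_cheb_le[of n] degree_cheb_le[of "Suc n"] by (auto intro: coeff_eq_0)
  then show ?case using 3 by simp
qed auto

lemma degree_cheb: "degree (cheb n) = n"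
  by (metis coeff_cheb degree_cheb_le le_degree le_antisym power_not_zero zero_neq_numeral)

lemma integral_cos_even_multiple:
  assumes "m \<noteq> (0 :: int)"
  shows "((\<lambda>t. cos (2 * of_int m * t)) has_integral 0) {0..pi/2}"
proof -
  have "((\<lambda>t. cos (2 * of_int m * t)) has_integral
      sin (2 * of_int m * (pi / 2)) / (2 * of_int m) - sin (2 * of_int m * 0) / (2 * of_int m)) {0..pi/2}"
    using assms
    by (intro fundamental_theorem_of_calculus)
      (auto intro!: derivative_eq_intros simp flip: has_real_derivative_iff_has_vector_derivative)
  moreover have "sin (2 * of_int m * (pi / 2)) = 0"
    using sin_int_times_real[of m] sin_npi_int by (simp add: mult.commute)
  ultimately show ?thesis by simp
qed

lemma cheb_orthogonal: "radial (cheb a * cheb b) = (if a = b then pi / 4 else 0)"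
proof -
  have eq: "poly (cheb a * cheb b) ((cos t)\<^sup>2) * (sin t)\<^sup>2
      = 1 / 2 * (cos (2 * of_int (int a - int b) * t) - cos (2 * of_int (int a + int b + 1) * t))" for t
  proof -
    have "poly (cheb a * cheb b) ((cos t)\<^sup>2) * (sin t)\<^sup>2 = sin ((2 * real a + 1) * t) * sin ((2 * real b + 1) * t)"
      unfolding cheb_trig[symmetric] by (simp add: power2_eq_square)
    also have "\<dots> = (cos ((2 * real a + 1) * t - (2 * real b + 1) * t) - cos ((2 * real a + 1) * t + (2 * real b + 1) * t)) / 2"
      by (rule sin_times_sin)
    finally show ?thesis by (simp add: algebra_simps)
  qed
  have "((\<lambda>t. cos (2 * of_int (int a - int b) * t)) has_integral (if a = b then pi / 2 else 0)) {0..pi/2}"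
    using integral_cos_even_multiple[of "int a - int b"] has_integral_const_real[of "1 :: real" 0 "pi/2"]
    by (cases "a = b") auto
  from has_integral_mult_right[OF has_integral_diff[OF this integral_cos_even_multiple[of "int a + int b + 1"]], of "1/2"]
  have "((\<lambda>t. poly (cheb a * cheb b) ((cos t)\<^sup>2) * (sin t)\<^sup>2) has_integral (if a = b then pi / 4 else 0)) {0..pi/2}"
    unfolding eq by (auto split: if_splits)
  then show ?thesis unfolding radial_def by (rule integral_unique)
qed

lemma cheb_expansion:
  assumes "degree p \<le> n"
  shows "p = (\<Sum>a\<le>n. smult (4 / pi * radial (p * cheb a)) (cheb a))"
proof -
  have "\<exists>c. p = (\<Sum>a\<le>n. smult (c a) (cheb a))"
    using assms
  proof (induction n arbitrary: p)
    case 0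
    then obtain c where "p = [:c:]" using degree_eq_zeroE by blast
    then show ?case by (intro exI[of _ "\<lambda>_. c"]) (simp add: one_pCons)
  next
    case (Suc n)
    define d where "d = coeff p (Suc n) / 4 ^ Suc n"
    have "degree (p - smult d (cheb (Suc n))) \<le> n"
    proof (rule degree_le, intro allI impI)
      fix i assume "n < i"
      then consider "i = Suc n" | "i > Suc n" by linarith
      then show "coeff (p - smult d (cheb (Suc n))) i = 0"
      proof cases
        case 1
        then show ?thesis by (simp add: d_def coeff_cheb)
      next
        case 2
        then have "coeff p i = 0" "coeff (cheb (Suc n)) i = 0"
          using Suc.prems by (auto intro!: coeff_eq_0 simp: degree_cheb)
        then show ?thesis by simp
      qed
    qed
    then obtain c where "p - smult d (cheb (Suc n)) = (\<Sum>a\<le>n. smult (c a) (cheb a))"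
      using Suc.IH by blast
    then show ?case
      by (intro exI[of _ "c(Suc n := d)"]) (simp add: algebra_simps)
  qed
  then obtain c where c: "p = (\<Sum>a\<le>n. smult (c a) (cheb a))" by blast
  have "radial (p * cheb b) = c b * (pi / 4)" if "b \<le> n" for b
  proof -
    have "radial (p * cheb b) = (\<Sum>a\<le>n. c a * radial (cheb a * cheb b))"
      by (subst c) (simp add: sum_distrib_right radial_sum radial_smult)
    then show ?thesis using that by (simp add: cheb_orthogonal if_distrib sum.delta cong: if_cong)
  qed
  then have "4 / pi * radial (p * cheb b) = c b" if "b \<le> n" for b
    using that by (simp add: field_simps)
  then have "(\<Sum>a\<le>n. smult (4 / pi * radial (p * cheb a)) (cheb a)) = (\<Sum>a\<le>n. smult (c a) (cheb a))"
    by (intro sum.cong) auto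
  then show ?thesis using c by simp
qed

lemma cheb_orthogonal_lower:
  assumes "degree p < a"
  shows "radial (p * cheb a) = 0"
proof -
  have "radial (p * cheb a) = (\<Sum>b\<le>degree p. 4 / pi * radial (p * cheb b) * radial (cheb b * cheb a))"
    by (subst cheb_expansion[OF order_refl, of p])
      (simp add: sum_distrib_right radial_sum radial_smult)
  also have "\<dots> = 0" using assms by (intro sum.neutral) (auto simp: cheb_orthogonal)
  finally show ?thesis .
qed

section \<open>Linear algebra in spaces of functions\<close>

lemma sum_fun_apply: "(\<Sum>i\<in>A. f i) x = (\<Sum>i\<in>A. f i x)" for f :: "'b \<Rightarrow> 'a \<Rightarrow> real"
  by (induction A rule: infinite_finite_induct) auto

lemma span_fun_finite:
  assumes "finite U"
  shows "f \<in> fun_space.span U \<longleftrightarrow> (\<exists>c. f = (\<lambda>x. \<Sum>u\<in>U. c u * u x))"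
  unfolding fun_space.span_finite[OF assms] by (auto simp: sum_fun_apply fun_eq_iff)

text \<open>Orthonormal families are independent, so their size is bounded and one of maximal size exists. If it
  did not span, the Gram-Schmidt step would extend it.\<close>

lemma orthonormal_basis_exists:
  fixes V :: "('a \<Rightarrow> real) set" and B :: "('a \<Rightarrow> real) \<Rightarrow> ('a \<Rightarrow> real) \<Rightarrow> real"
  assumes V: "fun_space.subspace V" "V \<subseteq> fun_space.span S" "finite S"
    and add: "\<And>f g h. f \<in> V \<Longrightarrow> g \<in> V \<Longrightarrow> h \<in> V \<Longrightarrow> B (\<lambda>x. f x + g x) h = B f h + B g h"
    and scale: "\<And>c f h. f \<in> V \<Longrightarrow> h \<in> V \<Longrightarrow> B (\<lambda>x. c * f x) h = c * B f h"
    and sym: "\<And>f g. B f g = B g f"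
    and pos: "\<And>f. f \<in> V \<Longrightarrow> f \<noteq> (\<lambda>x. 0) \<Longrightarrow> B f f > 0"
  shows "\<exists>U. finite U \<and> U \<subseteq> V \<and> fun_space.span U = V \<and> fun_space.independent U \<and>
    (\<forall>u\<in>U. \<forall>v\<in>U. B u v = (if u = v then 1 else 0))"
proof -
  have V_add: "(\<lambda>x. f x + g x) \<in> V" if "f \<in> V" "g \<in> V" for f g
    using fun_space.subspace_add[OF V(1) that] by (simp add: plus_fun_def)
  have V_scale: "(\<lambda>x. c * f x) \<in> V" if "f \<in> V" for c f
    using fun_space.subspace_scale[OF V(1) that] by simp
  have V_zero: "(\<lambda>x. 0) \<in> V"
    using fun_space.subspace_0[OF V(1)] by (simp add: zero_fun_def)
  have V_sum: "(\<lambda>x. \<Sum>u\<in>U. c u * u x) \<in> V \<and> (\<forall>h\<in>V. B (\<lambda>x. \<Sum>u\<in>U. c u * u x) h = (\<Sum>u\<in>U. c u * B u h))"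
    if "finite U" "U \<subseteq> V" for U c
    using that
  proof (induction U rule: finite_induct)
    case empty
    have "B (\<lambda>x. 0) h = 0" if "h \<in> V" for h
      using scale[OF that that, of 0] scale[OF V_zero that, of 0] by simp
    then show ?case by (simp add: V_zero)
  next
    case (insert u U)
    then show ?case by (auto simp: add V_add V_scale scale)
  qed
  define P where "P U \<longleftrightarrow> finite U \<and> U \<subseteq> V \<and> (\<forall>u\<in>U. \<forall>v\<in>U. B u v = (if u = v then 1 else 0))" for U
  have delta: "(\<Sum>u\<in>U. c u * B u v) = c v" if "P U" "v \<in> U" for U c v
  proof -
    have "(\<Sum>u\<in>U. c u * B u v) = (\<Sum>u\<in>U. if u = v then c u else 0)"
      using that by (intro sum.cong) (auto simp: P_def)
    then show ?thesis using that by (simp add: P_def)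
  qed
  have P_indep: "fun_space.independent U" if "P U" for U
  proof (rule fun_space.independent_if_scalars_zero)
    show "finite U" using that by (simp add: P_def)
    fix c v
    assume "(\<Sum>u\<in>U. (\<lambda>x. c u * u x)) = 0" "v \<in> U"
    then have 0: "(\<lambda>x. \<Sum>u\<in>U. c u * u x) = (\<lambda>x. 0)"
      by (auto simp: fun_eq_iff sum_fun_apply dest!: fun_cong)
    have U: "finite U" "U \<subseteq> V" and v: "v \<in> V" using that \<open>v \<in> U\<close> by (auto simp: P_def)
    have "(\<Sum>u\<in>U. c u * B u v) = B (\<lambda>x. \<Sum>u\<in>U. c u * u x) v" using V_sum[OF U] v by simp
    also have "\<dots> = 0" using V_sum[of "{}"] v unfolding 0 by simp
    finally have "(\<Sum>u\<in>U. c u * B u v) = 0" .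
    moreover have "(\<Sum>u\<in>U. c u * B u v) = c v"
      by (rule delta[OF that \<open>v \<in> U\<close>])
    ultimately show "c v = 0" by simp
  qed
  have "card U \<le> card S" if "P U" for U
    using fun_space.independent_span_bound[OF V(3) P_indep[OF that]] that V(2)
    by (auto simp: P_def)
  moreover have "P {}" by (simp add: P_def)
  ultimately obtain U where U: "P U" "\<And>U'. P U' \<Longrightarrow> card U' \<le> card U"
    using ex_has_greatest_nat[of P "{}" card "Suc (card S)"] by (meson le_imp_less_Suc)
  have "V \<subseteq> fun_space.span U"
  proof (rule ccontr)
    assume "\<not> V \<subseteq> fun_space.span U"
    then obtain f where f: "f \<in> V" "f \<notin> fun_space.span U" by blast
    define p where "p = (\<lambda>x. \<Sum>u\<in>U. B f u * u x)"
    define g where "g = (\<lambda>x. f x + (- 1) * p x)"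
    have p: "p \<in> V" "p \<in> fun_space.span U" "\<And>h. h \<in> V \<Longrightarrow> B p h = (\<Sum>u\<in>U. B f u * B u h)"
      using V_sum[of U] U(1) span_fun_finite[of U p] by (auto simp: P_def p_def)
    have g: "g \<in> V" unfolding g_def by (intro V_add V_scale f(1) p(1))
    have gB: "B g h = B f h - B p h" if "h \<in> V" for h
      unfolding g_def using add[OF f(1) V_scale[OF p(1), of "-1"] that] scale[OF p(1) that, of "-1"] by simp
    have gu: "B g v = 0" if "v \<in> U" for v
      using that U(1) p(3)[of v] gB[of v] delta[OF U(1) that, of "B f"] by (auto simp: P_def)
    have "g \<noteq> (\<lambda>x. 0)"
    proof
      assume "g = (\<lambda>x. 0)"
      then have "f = p" by (auto simp: g_def fun_eq_iff)
      then show False using f(2) p(2) by simp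
    qed
    then have pos_g: "B g g > 0" using pos[OF g] by simp
    define e where "e = (\<lambda>x. 1 / sqrt (B g g) * g x)"
    have e: "e \<in> V" unfolding e_def using V_scale[OF g] .
    have eB: "B e h = B g h / sqrt (B g g)" if "h \<in> V" for h
      unfolding e_def using scale[OF g that, of "1 / sqrt (B g g)"] by simp
    have "B e e = B g e / sqrt (B g g)" using eB[OF e] .
    also have "B g e = B g g / sqrt (B g g)" using eB[OF g] sym by metis
    finally have ee: "B e e = 1" using pos_g by simp
    have eu: "B e v = 0" "B v e = 0" if "v \<in> U" for v
      using eB[of v] gu[OF that] that U(1) sym[of e v] by (auto simp: P_def)
    have "e \<notin> U" using eu ee by force
    then have "P (insert e U)"
      using U(1) e ee eu by (auto simp: P_def)
    then have "card (insert e U) \<le> card U" using U(2) by blast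
    then show False using \<open>e \<notin> U\<close> U(1) by (simp add: P_def)
  qed
  moreover have "fun_space.span U \<subseteq> V"
    using U(1) V(1) by (intro fun_space.span_minimal) (auto simp: P_def)
  ultimately have "fun_space.span U = V" by (intro equalityI)
  moreover have "finite U" "U \<subseteq> V" "\<forall>u\<in>U. \<forall>v\<in>U. B u v = (if u = v then 1 else 0)"
    using U(1) unfolding P_def by blast+
  ultimately show ?thesis using P_indep[OF U(1)] by (intro exI[of _ U] conjI)
qed

lemma finite_monomials: "finite (monomial_fun ` {\<alpha> :: 'n::finite \<Rightarrow> nat. sum \<alpha> UNIV = m})"
  by (intro finite_imageI finite_subset[OF _ finite_multi_indices[of m]]) auto

section \<open>The reproducing kernel of a space of forms on the sphere\<close>

lemma forms_inner_pos:
  assumes "f \<in> forms m" "f \<noteq> (\<lambda>x. 0)"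
  shows "sphere_integral (\<lambda>x. f x * f x) > 0"
proof -
  have cont: "continuous_on UNIV (\<lambda>x. f x * f x)"
    using assms(1) by (intro continuous_intros forms_continuous)
  have "sphere_integral (\<lambda>x. f x * f x) \<noteq> 0"
  proof
    assume "sphere_integral (\<lambda>x. f x * f x) = 0"
    then have "f x = 0" if "norm x = 1" for x
      using sphere_integral_eq_0[OF cont _ _ that] by simp
    then show False using forms_vanishing[OF assms(1)] assms(2) by blast
  qed
  then show ?thesis using sphere_integral_nonneg[of "\<lambda>x. f x * f x"] by simp
qed

lemma forms_inner_add:
  assumes "f \<in> forms m" "g \<in> forms m'" "h \<in> forms l"
  shows "sphere_integral (\<lambda>x. (f x + g x) * h x) =
    sphere_integral (\<lambda>x. f x * h x) + sphere_integral (\<lambda>x. g x * h x)"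
  unfolding distrib_right
  using assms by (intro sphere_integral_add continuous_intros forms_continuous)

lemma forms_inner_scale:
  "sphere_integral (\<lambda>x. (c * f x) * h x) = c * sphere_integral (\<lambda>x. f x * h x)"
  unfolding mult.assoc by (rule sphere_integral_scale)

definition orthonormal_basis_of_forms :: "nat \<Rightarrow> (real ^ 'n::finite \<Rightarrow> real) set \<Rightarrow> bool" where
  "orthonormal_basis_of_forms m U \<longleftrightarrow> finite U \<and> U \<subseteq> forms m \<and> fun_space.span U = forms m \<and>
    fun_space.independent U \<and>
    (\<forall>u\<in>U. \<forall>v\<in>U. sphere_integral (\<lambda>x. u x * v x) = (if u = v then 1 else 0))"

lemma orthonormal_basis_of_forms_exists:
  "\<exists>U :: (real ^ 'n::finite \<Rightarrow> real) set. orthonormal_basis_of_forms m U"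
  unfolding orthonormal_basis_of_forms_def
proof (rule orthonormal_basis_exists[OF subspace_forms _ finite_monomials[of m]])
  show "forms m \<subseteq> fun_space.span (monomial_fun ` {\<alpha> :: 'n \<Rightarrow> nat. sum \<alpha> UNIV = m})"
    by (simp add: forms_def)
  show "sphere_integral (\<lambda>x. f x * g x) = sphere_integral (\<lambda>x. g x * f x)" for f g :: "real ^ 'n \<Rightarrow> real"
    by (simp add: mult.commute)
  show "sphere_integral (\<lambda>x. c * f x * h x) = c * sphere_integral (\<lambda>x. f x * h x)"
    for c and f h :: "real ^ 'n \<Rightarrow> real"
    by (rule forms_inner_scale)
  fix f g h :: "real ^ 'n \<Rightarrow> real"
  assume f: "f \<in> forms m"
  show "sphere_integral (\<lambda>x. f x * f x) > 0" if "f \<noteq> (\<lambda>x. 0)"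
    using f that by (rule forms_inner_pos)
  assume g: "g \<in> forms m" and h: "h \<in> forms m"
  show "sphere_integral (\<lambda>x. (f x + g x) * h x) =
      sphere_integral (\<lambda>x. f x * h x) + sphere_integral (\<lambda>x. g x * h x)"
    by (rule forms_inner_add[OF f g h])
qed

definition form_basis :: "nat \<Rightarrow> (real ^ 'n::finite \<Rightarrow> real) set" where
  "form_basis m = (SOME U. orthonormal_basis_of_forms m U)"

lemma form_basis_spec: "orthonormal_basis_of_forms m (form_basis m)"
  unfolding form_basis_def by (rule someI_ex[OF orthonormal_basis_of_forms_exists])

lemma finite_form_basis: "finite (form_basis m)"
  by (rule form_basis_spec[unfolded orthonormal_basis_of_forms_def, THEN conjunct1])

lemma form_basis_subset: "form_basis m \<subseteq> forms m"
  by (rule form_basis_spec[unfolded orthonormal_basis_of_forms_def, THEN conjunct2, THEN conjunct1])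

lemma span_form_basis: "fun_space.span (form_basis m) = forms m"
  by (rule form_basis_spec[unfolded orthonormal_basis_of_forms_def, THEN conjunct2, THEN conjunct2,
        THEN conjunct1])

lemma independent_form_basis: "fun_space.independent (form_basis m)"
  by (rule form_basis_spec[unfolded orthonormal_basis_of_forms_def, THEN conjunct2, THEN conjunct2,
        THEN conjunct2, THEN conjunct1])

lemma form_basis_orthonormal:
  "u \<in> form_basis m \<Longrightarrow> v \<in> form_basis m \<Longrightarrow>
    sphere_integral (\<lambda>x. u x * v x) = (if u = v then 1 else 0)"
  by (rule form_basis_spec[unfolded orthonormal_basis_of_forms_def, THEN conjunct2, THEN conjunct2,
        THEN conjunct2, THEN conjunct2, rule_format])

text \<open>For fixed \<open>m\<close> this represents point evaluation on \<open>forms m\<close> in the inner product of functions on the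
  sphere.\<close>

definition zonal :: "nat \<Rightarrow> real ^ 'n::finite \<Rightarrow> real ^ 'n \<Rightarrow> real" where
  "zonal m z y = (\<Sum>u\<in>form_basis m. u z * u y)"

abbreviation sphere_area :: "'n::finite itself \<Rightarrow> real" where
  "sphere_area _ \<equiv> sphere_integral (\<lambda>x :: real ^ 'n. 1)"

lemma sphere_area_pos: "sphere_area TYPE('n::finite) > 0"
  using forms_inner_pos[OF forms_const[of 1, where 'a='n]] by (simp add: fun_eq_iff)

lemma zonal_in_forms: "zonal m z \<in> forms m"
  unfolding zonal_def[abs_def] using form_basis_subset by (intro forms_sum forms_scale) auto

lemma zonal_commute: "zonal m z y = zonal m y z"
  by (simp add: zonal_def mult.commute)

lemma sphere_integral_sum:
  assumes "\<And>i. i \<in> A \<Longrightarrow> continuous_on UNIV (f i)"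
  shows "sphere_integral (\<lambda>x. \<Sum>i\<in>A. f i x) = (\<Sum>i\<in>A. sphere_integral (f i))"
  using assms
proof (induction A rule: infinite_finite_induct)
  case (insert a A)
  have "sphere_integral (\<lambda>x. f a x + (\<Sum>i\<in>A. f i x)) =
      sphere_integral (f a) + sphere_integral (\<lambda>x. \<Sum>i\<in>A. f i x)"
    using insert by (intro sphere_integral_add continuous_on_sum) auto
  then show ?case using insert by simp
qed (simp_all add: sphere_integral_def)

lemma zonal_reproducing:
  assumes "f \<in> forms m"
  shows "sphere_integral (\<lambda>y. zonal m z y * f y) = f z"
proof -
  obtain c where c: "f = (\<lambda>x. \<Sum>u\<in>form_basis m. c u * u x)"
    using assms unfolding span_form_basis[symmetric] span_fun_finite[OF finite_form_basis] by blast
  have cont: "continuous_on UNIV u" if "u \<in> form_basis m" for u :: "real ^ 'a \<Rightarrow> real"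
    using that form_basis_subset forms_continuous by blast
  have "sphere_integral (\<lambda>y. zonal m z y * f y) =
      sphere_integral (\<lambda>y. \<Sum>v\<in>form_basis m. \<Sum>u\<in>form_basis m. v z * c u * (v y * u y))"
    unfolding zonal_def c sum_product by (simp only: mult_ac)
  also have "\<dots> = (\<Sum>v\<in>form_basis m. sphere_integral (\<lambda>y. \<Sum>u\<in>form_basis m. v z * c u * (v y * u y)))"
    using cont by (intro sphere_integral_sum continuous_intros)
  also have "\<dots> = (\<Sum>v\<in>form_basis m. \<Sum>u\<in>form_basis m. v z * c u * sphere_integral (\<lambda>y. v y * u y))"
  proof (intro sum.cong refl)
    fix v :: "real ^ 'a \<Rightarrow> real" assume "v \<in> form_basis m"
    then have "sphere_integral (\<lambda>y. \<Sum>u\<in>form_basis m. v z * c u * (v y * u y)) =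
        (\<Sum>u\<in>form_basis m. sphere_integral (\<lambda>y. v z * c u * (v y * u y)))"
      using cont by (intro sphere_integral_sum continuous_intros)
    then show "sphere_integral (\<lambda>y. \<Sum>u\<in>form_basis m. v z * c u * (v y * u y)) =
        (\<Sum>u\<in>form_basis m. v z * c u * sphere_integral (\<lambda>y. v y * u y))"
      by (simp only: sphere_integral_scale)
  qed
  also have "\<dots> = (\<Sum>v\<in>form_basis m. v z * c v)"
    by (intro sum.cong refl) (simp add: finite_form_basis form_basis_orthonormal if_distrib sum.delta cong: if_cong)
  finally show ?thesis by (simp add: c mult.commute)
qed

lemma zonal_unique:
  assumes "g \<in> forms m" "\<And>f. f \<in> forms m \<Longrightarrow> sphere_integral (\<lambda>y. g y * f y) = f z"
  shows "g = zonal m z"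
proof (rule ccontr)
  assume ne: "g \<noteq> zonal m z"
  define h where "h = (\<lambda>x. g x + (- 1) * zonal m z x)"
  have h: "h \<in> forms m"
    unfolding h_def by (intro forms_add forms_scale zonal_in_forms assms)
  have "sphere_integral (\<lambda>y. h y * h y) =
      sphere_integral (\<lambda>y. g y * h y) + sphere_integral (\<lambda>y. (- 1 * zonal m z y) * h y)"
    unfolding h_def
    by (rule forms_inner_add[OF assms(1) forms_scale[OF zonal_in_forms] h[unfolded h_def]])
  also have "\<dots> = 0"
    unfolding forms_inner_scale by (simp add: assms(2)[OF h] zonal_reproducing[OF h])
  finally have "h = (\<lambda>x. 0)" using forms_inner_pos[OF h] by force
  then have "h x = 0" for x by simp
  then have "g x = zonal m z x" for x by (simp add: h_def)
  then show False using ne by blast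
qed

text \<open>The diagonal of the kernel is rotation invariant by uniqueness, hence constant on the unit
  sphere; its integral over the sphere is the trace of the identity, the dimension.\<close>

lemma zonal_diagonal_unit:
  fixes z :: "real ^ 'n::finite"
  assumes "norm z = 1"
  shows "zonal m z z = fun_space.dim (forms m :: (real ^ 'n \<Rightarrow> real) set) / sphere_area TYPE('n)"
proof -
  have const: "zonal m x x = zonal m z z" if "norm x = 1" for x :: "real ^ 'n"
  proof -
    have "norm x = norm z" using assms that by simp
    then obtain T where T: "orthogonal_transformation T" "T x = z"
      using orthogonal_transformation_exists by blast
    have lin: "linear T" using T(1) by (rule orthogonal_transformation_linear)
    define T' where "T' = inv T"
    have T': "linear T'" "\<And>x. T' (T x) = x"
      using orthogonal_transformation_linear[OF orthogonal_transformation_inv[OF T(1)]]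
        orthogonal_transformation_inj[OF T(1)] by (simp_all add: T'_def)
    have "(\<lambda>y. zonal m z (T y)) = zonal m x"
    proof (rule zonal_unique)
      show "(\<lambda>y. zonal m z (T y)) \<in> forms m"
        by (rule forms_compose_linear[OF lin zonal_in_forms])
      fix f :: "real ^ 'n \<Rightarrow> real" assume f: "f \<in> forms m"
      then have fT': "(\<lambda>y. f (T' y)) \<in> forms m" by (rule forms_compose_linear[OF T'(1)])
      have "sphere_integral (\<lambda>y. zonal m z (T y) * f (T' (T y))) =
          sphere_integral (\<lambda>y. zonal m z y * f (T' y))"
        by (rule sphere_integral_orthogonal[OF _ T(1)])
          (intro continuous_intros forms_continuous[OF zonal_in_forms] forms_continuous[OF fT'])
      also have "\<dots> = f (T' z)" by (rule zonal_reproducing[OF fT'])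
      finally show "sphere_integral (\<lambda>y. zonal m z (T y) * f y) = f x"
        using T'(2)[of x] T(2) by (simp add: T'(2))
    qed
    then show ?thesis using T(2) by metis
  qed
  have cont: "continuous_on UNIV u" if "u \<in> form_basis m" for u :: "real ^ 'n \<Rightarrow> real"
    using that form_basis_subset forms_continuous by blast
  have "zonal m z z * sphere_area TYPE('n) = sphere_integral (\<lambda>x :: real ^ 'n. zonal m z z * 1)"
    by (simp add: sphere_integral_scale[of "zonal m z z", symmetric])
  also have "\<dots> = sphere_integral (\<lambda>x :: real ^ 'n. \<Sum>u\<in>form_basis m. u x * u x)"
    using const cont by (intro sphere_integral_cong continuous_intros) (auto simp: zonal_def)
  also have "\<dots> = (\<Sum>u\<in>form_basis m. sphere_integral (\<lambda>x :: real ^ 'n. u x * u x))"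
    using cont by (intro sphere_integral_sum continuous_intros)
  also have "\<dots> = card (form_basis m :: (real ^ 'n \<Rightarrow> real) set)"
    by (simp add: form_basis_orthonormal)
  also have "card (form_basis m :: (real ^ 'n \<Rightarrow> real) set) = fun_space.dim (forms m :: (real ^ 'n \<Rightarrow> real) set)"
  proof -
    have "fun_space.dim (fun_space.span (form_basis m :: (real ^ 'n \<Rightarrow> real) set)) =
        card (form_basis m :: (real ^ 'n \<Rightarrow> real) set)"
      by (rule fun_space.dim_span_eq_card_independent[OF independent_form_basis])
    then show ?thesis by (simp add: span_form_basis)
  qed
  finally show ?thesis using sphere_area_pos[where 'n='n] by (simp add: field_simps)
qed

lemma zonal_diagonal:
  fixes z :: "real ^ 'n::finite"
  assumes "z \<noteq> 0"
  shows "zonal m z z = norm z ^ (2 * m) *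
    fun_space.dim (forms m :: (real ^ 'n \<Rightarrow> real) set) / sphere_area TYPE('n)"
proof -
  define v where "v = sgn z"
  have v: "z = norm z *\<^sub>R v" "norm v = 1" using assms by (simp_all add: v_def sgn_div_norm)
  have "zonal m z z = norm z ^ m * zonal m v z"
    using forms_homogeneous[OF zonal_in_forms, of m z "norm z" v] v(1) by (simp add: zonal_commute)
  also have "zonal m v z = norm z ^ m * zonal m v v"
    using forms_homogeneous[OF zonal_in_forms, of m v "norm z" v] v(1) by simp
  finally show ?thesis by (simp add: zonal_diagonal_unit[OF v(2)] mult_2 power_add)
qed

lemma zonal_degree_0:
  fixes z :: "real ^ 'n::finite"
  shows "zonal 0 z y = 1 / sphere_area TYPE('n)"
proof -
  have c: "zonal 0 z x = zonal 0 z 0" for x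
    using forms_homogeneous[OF zonal_in_forms, of 0 z 0 x] by simp
  have "(\<lambda>x. zonal 0 z 0 * 1) = (\<lambda>x. zonal 0 z x * 1)"
    by (rule ext) (metis c)
  then have "sphere_integral (\<lambda>x :: real ^ 'n. zonal 0 z 0 * 1) = 1"
    using zonal_reproducing[OF forms_const[of 1], of z] by metis
  then have "zonal 0 z 0 * sphere_area TYPE('n) = 1" unfolding sphere_integral_scale by simp
  then show ?thesis using sphere_area_pos[where 'n='n] c[of y] by (simp add: field_simps)
qed

lemma zonal_at_0: "m > 0 \<Longrightarrow> zonal m z 0 = 0"
  using forms_homogeneous[OF zonal_in_forms, of m z 0 0] by (auto simp: power_0_left)

section \<open>The reproducing kernel for even polynomials\<close>

text \<open>For \<open>y \<noteq> 0\<close> and \<open>degree p \<le> n\<close> this is \<open>norm y ^ (2 * n) * p (1 / (norm y)\<^sup>2)\<close>, written without division. It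
  turns polynomials in the variable \<open>s = 1 / r\<^sup>2\<close>, in which the radial weight is classical, into polynomial
  functions on the whole space.\<close>

definition rev_poly :: "nat \<Rightarrow> real poly \<Rightarrow> real ^ 'n::finite \<Rightarrow> real" where
  "rev_poly n p y = (\<Sum>b\<le>n. coeff p b * norm y ^ (2 * (n - b)))"

lemma rev_poly_eq:
  assumes "degree p \<le> n" "y \<noteq> 0"
  shows "rev_poly n p y = norm y ^ (2 * n) * poly p (1 / (norm y)\<^sup>2)"
proof -
  have "norm y ^ (2 * (n - b)) = norm y ^ (2 * n) * (1 / (norm y)\<^sup>2) ^ b" if "b \<le> n" for b
    using assms(2) that by (simp add: power_diff diff_mult_distrib2 power_mult power_divide)
  then have "rev_poly n p y = norm y ^ (2 * n) * (\<Sum>b\<le>n. coeff p b * (1 / (norm y)\<^sup>2) ^ b)"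
    by (simp add: rev_poly_def sum_distrib_left mult.left_commute)
  also have "(\<Sum>b\<le>n. coeff p b * (1 / (norm y)\<^sup>2) ^ b) = poly p (1 / (norm y)\<^sup>2)"
    unfolding poly_altdef using assms(1)
    by (intro sum.mono_neutral_right) (auto simp: coeff_eq_0)
  finally show ?thesis .
qed

lemma rev_poly_at_0: "rev_poly n p 0 = coeff p n"
proof -
  have "rev_poly n p 0 = (\<Sum>b\<le>n. if b = n then coeff p b else 0)"
    unfolding rev_poly_def by (intro sum.cong) (auto simp: power_0_left)
  then show ?thesis by simp
qed

lemma rev_poly_sum: "rev_poly n (\<Sum>i\<in>A. f i) y = (\<Sum>i\<in>A. rev_poly n (f i) y)"
  unfolding rev_poly_def coeff_sum sum_distrib_right by (rule sum.swap)

lemma rev_poly_smult: "rev_poly n (smult c p) y = c * rev_poly n p y"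
  by (simp add: rev_poly_def sum_distrib_left mult.assoc)

lemma rev_poly_shift:
  assumes "degree p \<le> n" "n \<le> m"
  shows "rev_poly n p y * norm y ^ (2 * (m - n)) = rev_poly m p y"
proof -
  have "rev_poly m p y = (\<Sum>b\<le>n. coeff p b * norm y ^ (2 * (m - b)))"
    unfolding rev_poly_def using assms by (intro sum.mono_neutral_right) (auto intro: coeff_eq_0)
  also have "\<dots> = (\<Sum>b\<le>n. coeff p b * norm y ^ (2 * (n - b)) * norm y ^ (2 * (m - n)))"
  proof (intro sum.cong refl)
    fix b assume "b \<in> {..n}"
    then have "2 * (m - b) = 2 * (n - b) + 2 * (m - n)" using assms(2) by auto
    then show "coeff p b * norm y ^ (2 * (m - b)) = coeff p b * norm y ^ (2 * (n - b)) * norm y ^ (2 * (m - n))"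
      by (simp add: power_add)
  qed
  finally show ?thesis by (simp add: rev_poly_def sum_distrib_right)
qed

lemma rev_poly_monom: "rev_poly n (monom 1 n) y = 1"
proof -
  have "rev_poly n (monom 1 n) y = (\<Sum>b\<le>n. if b = n then 1 else 0)"
    unfolding rev_poly_def by (intro sum.cong) (auto simp: coeff_monom)
  then show ?thesis by simp
qed

lemma rev_poly_in_even_polys:
  assumes "h \<in> forms (2 * j)" "2 * (n + j) \<le> t"
  shows "(\<lambda>y. rev_poly n p y * h y) \<in> even_polys t"
proof -
  have "(\<lambda>y. \<Sum>b\<le>n. coeff p b * (norm y ^ (2 * (n - b)) * h y)) \<in> even_polys t"
    using assms by (intro even_polys_sum even_polys_scale forms_in_even_polys[OF forms_norm_mult]) auto
  then show ?thesis by (simp add: rev_poly_def sum_distrib_right mult.assoc)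
qed

text \<open>In the coordinates \<open>s = 1 / (norm y)\<^sup>2\<close> and \<open>u = sgn y\<close>, an even polynomial of degree at most \<open>2 * k\<close> is
  \<open>norm y ^ (2 * k)\<close> times a sum of terms \<open>s ^ a * g u\<close> with \<open>g \<in> forms (2 * (k - a))\<close>. On the sphere the
  spaces \<open>forms (2 * j)\<close> increase with \<open>j\<close>, because \<open>norm u = 1\<close>. Hence \<open>s ^ a\<close> may be replaced by the
  orthogonal polynomial \<open>cheb a\<close>, which makes the sum orthogonal; the kernel is the corresponding sum of
  products of kernels, and forms need not be split into harmonic components.\<close>

definition even_kernel :: "nat \<Rightarrow> real ^ 'n::finite \<Rightarrow> real ^ 'n \<Rightarrow> real" where
  "even_kernel k z y = 4 / pi *
    (\<Sum>a\<le>k. rev_poly a (cheb a) z * rev_poly a (cheb a) y * zonal (2 * (k - a)) z y)"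

lemma even_kernel_in_even_polys: "even_kernel k z \<in> even_polys (2 * k)"
proof -
  have "(\<lambda>y. 4 / pi * (\<Sum>a\<le>k. rev_poly a (cheb a) z * (rev_poly a (cheb a) y * zonal (2 * (k - a)) z y)))
      \<in> even_polys (2 * k)"
    by (intro even_polys_scale even_polys_sum rev_poly_in_even_polys[OF zonal_in_forms]) auto
  then show ?thesis by (simp add: even_kernel_def[abs_def] mult.assoc)
qed

lemma even_kernel_at_0:
  fixes z :: "real ^ 'n::finite"
  shows "even_kernel k z 0 = 4 / pi * 4 ^ k / sphere_area TYPE('n) * rev_poly k (cheb k) z"
proof -
  have "(\<Sum>a\<le>k. rev_poly a (cheb a) z * rev_poly a (cheb a) (0 :: real ^ 'n) * zonal (2 * (k - a)) z 0) =
     (\<Sum>a\<le>k. if a = k then rev_poly k (cheb k) z * 4 ^ k / sphere_area TYPE('n) else 0)"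
    by (intro sum.cong refl) (auto simp: rev_poly_at_0 coeff_cheb zonal_at_0 zonal_degree_0)
  also have "\<dots> = rev_poly k (cheb k) z * 4 ^ k / sphere_area TYPE('n)" by simp
  finally show ?thesis unfolding even_kernel_def by simp
qed

lemma even_kernel_diagonal:
  fixes z :: "real ^ 'n::finite"
  assumes "z \<noteq> 0"
  shows "even_kernel k z z = 4 / pi * norm z ^ (4 * k) / sphere_area TYPE('n) *
    (\<Sum>a\<le>k. fun_space.dim (forms (2 * (k - a)) :: (real ^ 'n \<Rightarrow> real) set) *
      (poly (cheb a) (1 / (norm z)\<^sup>2))\<^sup>2)"
proof -
  have "rev_poly a (cheb a) z * rev_poly a (cheb a) z * zonal (2 * (k - a)) z z =
      norm z ^ (4 * k) / sphere_area TYPE('n) *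
      (fun_space.dim (forms (2 * (k - a)) :: (real ^ 'n \<Rightarrow> real) set) * (poly (cheb a) (1 / (norm z)\<^sup>2))\<^sup>2)"
    if "a \<le> k" for a
  proof -
    have "norm z ^ (2 * a) * norm z ^ (2 * a) * norm z ^ (2 * (2 * (k - a))) = norm z ^ (4 * k)"
    proof -
      have "2 * a + 2 * a + 2 * (2 * (k - a)) = 4 * k" using that by simp
      then show ?thesis by (metis power_add)
    qed
    then show ?thesis
      by (simp add: rev_poly_eq degree_cheb assms zonal_diagonal power2_eq_square)
  qed
  then show ?thesis by (simp add: even_kernel_def sum_distrib_left mult.assoc)
qed

section \<open>Cubature formulas for the weighted integral\<close>

locale weighted_cubature =
  fixes k :: nat and X :: "(real ^ 'n::finite) set" and w :: "real ^ 'n \<Rightarrow> real"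
  assumes cubature: "cubature_formula (weighted_integral k) (4 * k + 1) X w"
begin

definition quad :: "(real ^ 'n \<Rightarrow> real) \<Rightarrow> real" where
  "quad f = (\<Sum>x\<in>X. w x * f x)"

lemma finite_X: "finite X" and weight_pos: "x \<in> X \<Longrightarrow> w x > 0"
  and quad_exact: "f \<in> polys (4 * k + 1) \<Longrightarrow> quad f = weighted_integral k f"
  using cubature by (auto simp: cubature_formula_def quad_def)

lemma quad_scale: "quad (\<lambda>x. c * f x) = c * quad f"
  by (simp add: quad_def sum_distrib_left mult.left_commute)

lemma quad_sum: "quad (\<lambda>x. \<Sum>i\<in>A. f i x) = (\<Sum>i\<in>A. quad (f i))"
  unfolding quad_def sum_distrib_left by (rule sum.swap)

lemma quad_odd:
  assumes "f \<in> polys (4 * k + 1)" "\<And>x. f (- x) = - f x"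
  shows "quad f = 0"
proof -
  obtain h where h: "\<And>m. h m \<in> forms m" "f = (\<lambda>x. \<Sum>m\<le>4 * k + 1. h m x)"
    using polys_decompose[OF assms(1)] by metis
  have "continuous_on UNIV (\<lambda>x. f (r *\<^sub>R x))" for r
    unfolding h(2) forms_homogeneous[OF h(1)]
    by (intro continuous_intros forms_continuous[OF h(1)])
  then have "sphere_integral (\<lambda>x. f (r *\<^sub>R x)) = 0" for r
    using assms(2) by (intro sphere_integral_odd) auto
  then show ?thesis
    by (simp add: quad_exact[OF assms(1)] weighted_integral_def sphere_integral_def)
qed

text \<open>On a form the spherical and the radial integration separate.\<close>

lemma quad_form:
  assumes "h \<in> forms (2 * j)" "j \<le> 2 * k"
  shows "quad h = sphere_integral h * radial (monom 1 (2 * k - j))"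
proof -
  have "quad h = weighted_integral k h"
    using assms by (intro quad_exact forms_subset_polys[OF assms(1)]) auto
  also have "\<dots> = (LINT r:{1..}|lborel. sphere_integral h * (sqrt (r\<^sup>2 - 1) / r ^ (2 * (2 * k - j) + 3)))"
    unfolding weighted_integral_def
  proof (rule set_lebesgue_integral_cong, simp, intro allI impI)
    fix r :: real assume r: "r \<in> {1..}"
    have "(LINT x|sphere_measure. h (r *\<^sub>R x)) = r ^ (2 * j) * sphere_integral h"
      by (simp add: forms_homogeneous[OF assms(1)] sphere_integral_def)
    moreover have "r ^ (4 * k + 3) = r ^ (2 * j) * r ^ (2 * (2 * k - j) + 3)"
    proof -
      have "2 * j + (2 * (2 * k - j) + 3) = 4 * k + 3" using assms(2) by simp
      then show ?thesis by (metis power_add)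
    qed
    ultimately show "(LINT x|sphere_measure. h (r *\<^sub>R x)) * sqrt (r\<^sup>2 - 1) / r ^ (4 * k + 3) =
        sphere_integral h * (sqrt (r\<^sup>2 - 1) / r ^ (2 * (2 * k - j) + 3))"
      using r by simp
  qed
  also have "\<dots> = sphere_integral h * radial_moment (2 * k - j)"
    unfolding radial_moment_def by (rule set_integral_mult_right)
  finally show ?thesis by (simp only: radial_moment_eq)
qed

lemma quad_rev_poly:
  assumes "h \<in> forms (2 * j)" "degree p \<le> n" "n + j \<le> 2 * k"
  shows "quad (\<lambda>y. rev_poly n p y * h y) = sphere_integral h * radial (p * monom 1 (2 * k - n - j))"
proof -
  have "quad (\<lambda>y. rev_poly n p y * h y) = quad (\<lambda>y. \<Sum>b\<le>n. coeff p b * (norm y ^ (2 * (n - b)) * h y))"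
    by (simp add: rev_poly_def sum_distrib_right mult.assoc)
  also have "\<dots> = (\<Sum>b\<le>n. coeff p b * quad (\<lambda>y. norm y ^ (2 * (n - b)) * h y))"
    unfolding quad_sum quad_scale ..
  also have "\<dots> = (\<Sum>b\<le>n. coeff p b * (sphere_integral h * radial (monom 1 (b + (2 * k - n - j)))))"
  proof (intro sum.cong refl arg_cong2[where f = "(*)"])
    fix b assume b: "b \<in> {..n}"
    have "quad (\<lambda>y. norm y ^ (2 * (n - b)) * h y) =
        sphere_integral (\<lambda>y. norm y ^ (2 * (n - b)) * h y) * radial (monom 1 (2 * k - (n - b + j)))"
      using assms(3) by (intro quad_form forms_norm_mult[OF assms(1)]) auto
    also have "sphere_integral (\<lambda>y. norm y ^ (2 * (n - b)) * h y) = sphere_integral h"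
      by (intro sphere_integral_cong continuous_intros forms_continuous[OF assms(1)]) auto
    also have "2 * k - (n - b + j) = b + (2 * k - n - j)" using b assms(3) by auto
    finally show "quad (\<lambda>y. norm y ^ (2 * (n - b)) * h y) =
        sphere_integral h * radial (monom 1 (b + (2 * k - n - j)))" .
  qed
  also have "\<dots> = sphere_integral h * (\<Sum>b\<le>n. radial (monom (coeff p b) b * monom 1 (2 * k - n - j)))"
  proof -
    have "radial (monom (coeff p b) b * monom 1 m) = coeff p b * radial (monom 1 (b + m))" for b m
      using radial_smult[of "coeff p b" "monom 1 (b + m)"] by (simp add: mult_monom smult_monom)
    then show ?thesis by (simp add: sum_distrib_left mult.left_commute)
  qed
  also have "(\<Sum>b\<le>n. radial (monom (coeff p b) b * monom 1 (2 * k - n - j))) = radial (p * monom 1 (2 * k - n - j))"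
    unfolding radial_sum[symmetric] sum_distrib_right[symmetric]
    by (simp add: poly_as_sum_of_monoms'[OF assms(2)])
  finally show ?thesis .
qed

text \<open>The radial integral of \<open>cheb a\<close> against \<open>s ^ (k - j)\<close> vanishes for \<open>a > k - j\<close>. For the other \<open>a\<close> the form \<open>g\<close>
  agrees on the sphere with one of degree \<open>2 * (k - a)\<close>, which the zonal kernel reproduces. What remains is
  the expansion of \<open>s ^ (k - j)\<close> in the polynomials \<open>cheb a\<close>.\<close>

lemma even_kernel_reproducing_form:
  assumes g: "g \<in> forms (2 * j)" and j: "j \<le> k"
  shows "quad (\<lambda>y. even_kernel k z y * g y) = g z"
proof -
  define s where "s = (monom 1 (k - j) :: real poly)"
  have deg_s: "degree s = k - j" by (simp add: s_def degree_monom_eq)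
  have summand: "quad (\<lambda>y. rev_poly a (cheb a) y * (zonal (2 * (k - a)) z y * g y)) * rev_poly a (cheb a) z =
      (if a \<le> k - j then radial (s * cheb a) * rev_poly (k - j) (cheb a) z * g z else 0)"
    if a: "a \<le> k" for a
  proof -
    have zg: "(\<lambda>y. zonal (2 * (k - a)) z y * g y) \<in> forms (2 * (k - a + j))"
      using forms_mult[OF zonal_in_forms g, of "2 * (k - a)" z] by (simp add: algebra_simps)
    have "quad (\<lambda>y. rev_poly a (cheb a) y * (zonal (2 * (k - a)) z y * g y)) =
        sphere_integral (\<lambda>y. zonal (2 * (k - a)) z y * g y) * radial (cheb a * monom 1 (2 * k - a - (k - a + j)))"
      using a j by (intro quad_rev_poly[OF zg]) (auto simp: degree_cheb)
    also have "2 * k - a - (k - a + j) = k - j" using a j by auto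
    finally have q: "quad (\<lambda>y. rev_poly a (cheb a) y * (zonal (2 * (k - a)) z y * g y)) =
        sphere_integral (\<lambda>y. zonal (2 * (k - a)) z y * g y) * radial (s * cheb a)"
      by (simp add: s_def mult.commute)
    show ?thesis
    proof (cases "a \<le> k - j")
      case False
      then show ?thesis using q cheb_orthogonal_lower[of s a] deg_s by simp
    next
      case True
      have g': "(\<lambda>y. norm y ^ (2 * (k - j - a)) * g y) \<in> forms (2 * (k - a))"
        using forms_norm_mult[OF g, of "k - j - a"] True j by (simp add: algebra_simps)
      have "sphere_integral (\<lambda>y. zonal (2 * (k - a)) z y * g y) =
          sphere_integral (\<lambda>y. zonal (2 * (k - a)) z y * (norm y ^ (2 * (k - j - a)) * g y))"
        by (intro sphere_integral_cong continuous_intros forms_continuous[OF zonal_in_forms]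
            forms_continuous[OF g]) auto
      also have "\<dots> = norm z ^ (2 * (k - j - a)) * g z"
        by (rule zonal_reproducing[OF g'])
      finally have "quad (\<lambda>y. rev_poly a (cheb a) y * (zonal (2 * (k - a)) z y * g y)) * rev_poly a (cheb a) z =
          radial (s * cheb a) * (rev_poly a (cheb a) z * norm z ^ (2 * (k - j - a))) * g z"
        unfolding q by simp
      also have "rev_poly a (cheb a) z * norm z ^ (2 * (k - j - a)) = rev_poly (k - j) (cheb a) z"
        using True by (intro rev_poly_shift) (auto simp: degree_cheb)
      finally show ?thesis using True by simp
    qed
  qed
  have "quad (\<lambda>y. even_kernel k z y * g y) =
      quad (\<lambda>y. \<Sum>a\<le>k. (4 / pi * rev_poly a (cheb a) z) * (rev_poly a (cheb a) y * (zonal (2 * (k - a)) z y * g y)))"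
    by (simp add: even_kernel_def sum_distrib_left sum_distrib_right mult.assoc)
  also have "\<dots> = (\<Sum>a\<le>k. 4 / pi * (quad (\<lambda>y. rev_poly a (cheb a) y * (zonal (2 * (k - a)) z y * g y)) * rev_poly a (cheb a) z))"
    unfolding quad_sum quad_scale by (simp only: mult_ac)
  also have "\<dots> = (\<Sum>a\<le>k. if a \<le> k - j then 4 / pi * (radial (s * cheb a) * rev_poly (k - j) (cheb a) z * g z) else 0)"
    using summand by (intro sum.cong) auto
  also have "\<dots> = (\<Sum>a\<le>k - j. 4 / pi * (radial (s * cheb a) * rev_poly (k - j) (cheb a) z * g z))"
    by (rule sum.mono_neutral_cong_right) auto
  also have "\<dots> = rev_poly (k - j) (\<Sum>a\<le>k - j. smult (4 / pi * radial (s * cheb a)) (cheb a)) z * g z"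
    by (simp add: rev_poly_sum rev_poly_smult sum_distrib_right mult.assoc)
  also have "(\<Sum>a\<le>k - j. smult (4 / pi * radial (s * cheb a)) (cheb a)) = s"
    by (rule cheb_expansion[symmetric]) (simp add: deg_s)
  finally show ?thesis by (simp add: s_def rev_poly_monom)
qed

lemma even_kernel_reproducing:
  assumes "g \<in> even_polys (2 * k)"
  shows "quad (\<lambda>y. even_kernel k z y * g y) = g z"
proof -
  obtain h where h: "\<And>j. h j \<in> forms (2 * j)" "g = (\<lambda>x. \<Sum>j\<le>k. h j x)"
    using even_polys_decompose[OF assms] by metis
  have "quad (\<lambda>y. even_kernel k z y * g y) = (\<Sum>j\<le>k. quad (\<lambda>y. even_kernel k z y * h j y))"
    by (simp add: h(2) sum_distrib_left quad_sum)
  also have "\<dots> = g z"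
    unfolding h(2) by (intro sum.cong refl even_kernel_reproducing_form[OF h(1)]) auto
  finally show ?thesis .
qed

text \<open>The reproducing property recovers an even polynomial from its values at the nodes.\<close>

lemma even_poly_determined_on_nodes:
  assumes "g \<in> even_polys (2 * k)" "\<And>x. x \<in> X \<Longrightarrow> g x = 0"
  shows "g z = 0"
  using even_kernel_reproducing[OF assms(1), of z] assms(2) by (simp add: quad_def)

end

section \<open>Restrictions of spaces of functions\<close>

text \<open>Extension by zero keeps restrictions within one type of functions, so that they form a subspace.\<close>

definition cut :: "'a set \<Rightarrow> ('a \<Rightarrow> real) \<Rightarrow> 'a \<Rightarrow> real" where
  "cut S f = (\<lambda>x. if x \<in> S then f x else 0)"

lemma subspace_image_cut:
  assumes "fun_space.subspace V"
  shows "fun_space.subspace (cut S ` V)"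
  unfolding fun_space.subspace_def
proof (intro conjI ballI allI)
  have "0 = cut S 0" by (simp add: cut_def fun_eq_iff)
  then show "0 \<in> cut S ` V" using fun_space.subspace_0[OF assms] by blast
next
  fix f g assume "f \<in> cut S ` V" "g \<in> cut S ` V"
  then obtain f' g' where "f' \<in> V" "g' \<in> V" "f = cut S f'" "g = cut S g'" by blast
  moreover have "cut S f' + cut S g' = cut S (f' + g')" by (simp add: cut_def fun_eq_iff)
  ultimately show "f + g \<in> cut S ` V" using fun_space.subspace_add[OF assms] by blast
next
  fix c f assume "f \<in> cut S ` V"
  then obtain f' where "f' \<in> V" "f = cut S f'" by blast
  moreover have "(\<lambda>x. c * cut S f' x) = cut S (\<lambda>x. c * f' x)" by (simp add: cut_def fun_eq_iff)
  ultimately show "(\<lambda>x. c * f x) \<in> cut S ` V" using fun_space.subspace_scale[OF assms] by blast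
qed

lemma dim_image_linear_injective:
  fixes T :: "('a \<Rightarrow> real) \<Rightarrow> ('b \<Rightarrow> real)"
  assumes V: "fun_space.subspace V"
    and add: "\<And>f g. T (f + g) = T f + T g" and scale: "\<And>c f. T (\<lambda>x. c * f x) = (\<lambda>x. c * T f x)"
    and inj: "\<And>f. f \<in> V \<Longrightarrow> T f = 0 \<Longrightarrow> f = 0"
  shows "fun_space.dim (T ` V) = fun_space.dim V"
proof -
  interpret T: Vector_Spaces.linear "\<lambda>(c::real) (f :: 'a \<Rightarrow> real) x. c * f x" "\<lambda>(c::real) (f :: 'b \<Rightarrow> real) x. c * f x" T
    by unfold_locales (auto simp: add scale)
  obtain B where B: "B \<subseteq> V" "fun_space.independent B" "V \<subseteq> fun_space.span B" "card B = fun_space.dim V"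
    using fun_space.basis_exists by blast
  have span_B: "fun_space.span B = V"
    using B(3) fun_space.span_minimal[OF B(1) V] by blast
  have inj_on: "inj_on T V"
    using T.inj_on_iff_eq_0[OF V] inj by blast
  then have "fun_space.independent (T ` B)"
    using T.independent_injective_image[OF B(2)] span_B by simp
  moreover have "fun_space.span (T ` V) = T ` V"
    using T.subspace_image[OF V] by (simp only: fun_space.span_eq_iff)
  then have "fun_space.span (T ` B) = fun_space.span (T ` V)"
    by (simp only: T.span_image span_B)
  ultimately have "fun_space.dim (T ` V) = card (T ` B)"
    by (intro fun_space.dim_eq_card)
  also have "\<dots> = card B"
    by (rule card_image[OF inj_on_subset[OF inj_on B(1)]])
  finally show ?thesis using B(4) by simp
qed

lemma dim_image_cut:
  assumes "fun_space.subspace V" "\<And>f. f \<in> V \<Longrightarrow> (\<And>x. x \<in> S \<Longrightarrow> f x = 0) \<Longrightarrow> f = (\<lambda>x. 0)"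
  shows "fun_space.dim (cut S ` V) = fun_space.dim V"
proof (rule dim_image_linear_injective[OF assms(1)])
  fix f assume "f \<in> V" "cut S f = 0"
  then have "cut S f x = 0" for x by simp
  then have "f x = 0" if "x \<in> S" for x using that by (metis cut_def)
  then show "f = 0" using assms(2)[OF \<open>f \<in> V\<close>] by (simp add: zero_fun_def)
qed (auto simp: cut_def fun_eq_iff)

lemma independent_Un_trivial_intersection:
  assumes C: "finite C" "fun_space.independent C" and D: "finite D" "fun_space.independent D"
    and trivial: "\<And>f. f \<in> fun_space.span C \<Longrightarrow> f \<in> fun_space.span D \<Longrightarrow> f = 0"
  shows "fun_space.independent (C \<union> D)" "C \<inter> D = {}"
proof -
  show disj: "C \<inter> D = {}"
    using trivial fun_space.span_base fun_space.dependent_zero C(2) by blast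
  show "fun_space.independent (C \<union> D)"
  proof (rule fun_space.independent_if_scalars_zero)
    show "finite (C \<union> D)" using C D by simp
    fix c v assume 0: "(\<Sum>u\<in>C \<union> D. (\<lambda>x. c u * u x)) = 0" and v: "v \<in> C \<union> D"
    define f g where "f = (\<Sum>u\<in>C. (\<lambda>x. c u * u x))" and "g = (\<Sum>u\<in>D. (\<lambda>x. c u * u x))"
    have "f + g = 0" using 0 C(1) D(1) disj by (simp add: f_def g_def sum.union_disjoint)
    then have "f = - g" by (simp add: eq_neg_iff_add_eq_0)
    have span: "f \<in> fun_space.span C" "g \<in> fun_space.span D"
      unfolding f_def g_def by (intro fun_space.span_sum fun_space.span_scale fun_space.span_base; assumption)+
    then have "f \<in> fun_space.span D" unfolding \<open>f = - g\<close> by (intro fun_space.span_neg)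
    then have "f = 0" using trivial span by blast
    moreover have "g = 0" using \<open>f = 0\<close> \<open>f + g = 0\<close> by simp
    ultimately show "c v = 0"
      using v fun_space.independentD[OF C(2) C(1) order_refl, of c v]
        fun_space.independentD[OF D(2) D(1) order_refl, of c v]
      by (auto simp: f_def g_def)
  qed
qed

lemma exists_vector_not_orthogonal:
  fixes Z :: "'a::euclidean_space set"
  assumes "finite Z" "0 \<notin> Z"
  obtains a where "\<And>z. z \<in> Z \<Longrightarrow> a \<bullet> z \<noteq> 0"
proof -
  have "negligible (\<Union>z\<in>Z. {x. z \<bullet> x = 0})"
    using assms by (intro negligible_Union) (auto intro!: negligible_hyperplane)
  then have "(\<Union>z\<in>Z. {x. z \<bullet> x = 0}) \<noteq> UNIV"
    using non_negligible_UNIV by metis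
  then obtain a where "a \<notin> (\<Union>z\<in>Z. {x. z \<bullet> x = 0})" by blast
  then show ?thesis using that[of a] by (auto simp: inner_commute)
qed

section \<open>Minimal cubature formulas are antipodal\<close>

lemma dim_even_polys_Omega:
  "fun_space.dim (even_polys_Omega t :: (real ^ 'n::finite \<Rightarrow> real) set) = fun_space.dim (even_polys t :: (real ^ 'n \<Rightarrow> real) set)"
proof -
  have "even_polys_Omega t = cut Omega ` (even_polys t :: (real ^ 'n \<Rightarrow> real) set)"
    by (auto simp: even_polys_Omega_def even_polys_def cut_def)
  moreover have "fun_space.dim (cut Omega ` (even_polys t :: (real ^ 'n \<Rightarrow> real) set)) =
      fun_space.dim (even_polys t :: (real ^ 'n \<Rightarrow> real) set)"
  proof (rule dim_image_cut[OF subspace_even_polys])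
    fix f :: "real ^ 'n \<Rightarrow> real" assume f: "f \<in> even_polys t" "\<And>x. x \<in> Omega \<Longrightarrow> f x = 0"
    then have "f \<in> polys t" by (simp add: even_polys_def)
    from polys_vanishing_Omega[OF this f(2)] show "f = (\<lambda>x. 0)" by blast
  qed
  ultimately show ?thesis by simp
qed

lemma nonzero_neq_minus: "x \<noteq> 0 \<Longrightarrow> x \<noteq> - x" for x :: "'a::real_vector"
  by (simp add: eq_neg_iff_add_eq_0 flip: scaleR_2)

locale minimal_cubature =
  fixes k :: nat and X :: "(real ^ 'n::finite) set" and w :: "real ^ 'n \<Rightarrow> real"
  assumes minimal: "minimal_cubature_formula k X w" and k_pos: "k \<ge> 1"
begin

sublocale weighted_cubature k X w
  using minimal by unfold_locales (simp add: minimal_cubature_formula_def)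

definition Z :: "(real ^ 'n) set" where "Z = X - {0}"

abbreviation E :: "(real ^ 'n \<Rightarrow> real) set" where "E \<equiv> even_polys (2 * k)"

lemma finite_Z: "finite Z" and zero_in_X: "0 \<in> X" and in_X_iff: "x \<in> X \<longleftrightarrow> x = 0 \<or> x \<in> Z"
  and X_eq: "X = insert 0 Z" and zero_notin_Z: "0 \<notin> Z"
  using finite_X minimal by (auto simp: Z_def minimal_cubature_formula_def)

lemma card_Z: "card Z + 2 = 2 * fun_space.dim E"
proof -
  have "int (card X) = 2 * int (fun_space.dim E) - 1"
    using minimal by (simp add: minimal_cubature_formula_def dim_even_polys_Omega)
  moreover have "card X = Suc (card Z)"
    using arg_cong[OF X_eq, of card] finite_Z zero_notin_Z by simp
  ultimately show ?thesis by linarith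
qed

lemma weight_pos_Z: "x \<in> Z \<Longrightarrow> w x > 0"
  by (simp add: in_X_iff weight_pos)

lemma quad_split: "quad f = w 0 * f 0 + (\<Sum>x\<in>Z. w x * f x)"
  unfolding quad_def using arg_cong[OF X_eq, of "sum (\<lambda>x. w x * f x)"] finite_Z zero_notin_Z by simp

lemma quad_odd_product:
  assumes "f \<in> E" "g \<in> E"
  shows "(\<Sum>x\<in>Z. w x * ((a \<bullet> x) * f x * g x)) = 0"
proof -
  have "(\<lambda>x. f x * g x) \<in> polys (4 * k)"
    using assms by (intro polys_mult[where s = "2 * k" and t = "2 * k"]) (auto simp: even_polys_def)
  from polys_mult_form[OF this forms_linear, of "4 * k + 1" a]
  have "(\<lambda>x. f x * g x * (a \<bullet> x)) \<in> polys (4 * k + 1)" by simp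
  then have "quad (\<lambda>x. f x * g x * (a \<bullet> x)) = 0"
    using assms by (intro quad_odd) (auto simp: even_polys_def)
  then have "(\<Sum>x\<in>Z. w x * (f x * g x * (a \<bullet> x))) = 0"
    unfolding quad_split by simp
  then show ?thesis by (simp only: mult_ac)
qed

text \<open>Let \<open>A\<close> be the restriction of \<open>E\<close> to \<open>Z\<close>. Multiplication by a linear form without zeros on \<open>Z\<close> carries
  \<open>A\<close> to a space of the same dimension, and by exactness on odd polynomials this space is orthogonal to
  \<open>A\<close>. So \<open>2 * dim A\<close> is at most the number \<open>2 * dim E - 2\<close> of nodes in \<open>Z\<close>. On the other hand
  \<open>dim A \<ge> dim E - 1\<close>, as an even polynomial is determined by its values on \<open>Z\<close> and at \<open>0\<close>. Hence equality
  holds, and the two spaces together contain every function on \<open>Z\<close>.\<close>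

context
  fixes a :: "real ^ 'n"
  assumes a: "\<And>z. z \<in> Z \<Longrightarrow> a \<bullet> z \<noteq> 0"
begin

lemma dim_restricted: "fun_space.dim (cut Z ` E) + 1 = fun_space.dim E"
  and functions_on_Z: "\<exists>f\<in>E. \<exists>g\<in>E. \<forall>z\<in>Z. h z = f z + (a \<bullet> z) * g z"
proof -
  define A where "A = cut Z ` E"
  define M where "M f = (\<lambda>x. (a \<bullet> x) * f x)" for f :: "real ^ 'n \<Rightarrow> real"
  define \<delta> where "\<delta> z = (\<lambda>x :: real ^ 'n. if x = z then 1 else 0 :: real)" for z
  have A: "fun_space.subspace A"
    unfolding A_def by (rule subspace_image_cut[OF subspace_even_polys])
  have off: "f x = 0" if "f \<in> A" "x \<notin> Z" for f x using that by (auto simp: A_def cut_def)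
  have in_span: "f \<in> fun_space.span (\<delta> ` Z)" if "\<And>x. x \<notin> Z \<Longrightarrow> f x = 0" for f
  proof -
    have "(\<Sum>z\<in>Z. f z * \<delta> z x) = f x" for x
      using that[of x] finite_Z by (cases "x \<in> Z") (simp_all add: \<delta>_def if_distrib cong: if_cong)
    then have "f = (\<Sum>z\<in>Z. (\<lambda>x. f z * \<delta> z x))" by (simp add: fun_eq_iff sum_fun_apply)
    moreover have "(\<Sum>z\<in>Z. (\<lambda>x. f z * \<delta> z x)) \<in> fun_space.span (\<delta> ` Z)"
      by (intro fun_space.span_sum fun_space.span_scale fun_space.span_base) auto
    ultimately show ?thesis by simp
  qed
  have finite_span: "finite (\<delta> ` Z)" "card (\<delta> ` Z) \<le> card Z"
    using finite_Z by (auto intro: card_image_le)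
  obtain C where C: "C \<subseteq> A" "fun_space.independent C" "A \<subseteq> fun_space.span C" "card C = fun_space.dim A"
    using fun_space.basis_exists by blast
  have span_C: "fun_space.span C = A" using C(3) fun_space.span_minimal[OF C(1) A] by blast
  have "finite C"
    using fun_space.independent_span_bound[OF finite_span(1) C(2)] C(1) in_span off by blast
  have MA: "fun_space.subspace (M ` A)" "fun_space.dim (M ` A) = fun_space.dim A"
  proof -
    interpret M: Vector_Spaces.linear "\<lambda>(c::real) (f :: real ^ 'n \<Rightarrow> real) x. c * f x" "\<lambda>(c::real) (f :: real ^ 'n \<Rightarrow> real) x. c * f x" M
      by unfold_locales (auto simp: M_def fun_eq_iff algebra_simps)
    show "fun_space.subspace (M ` A)" by (rule M.subspace_image[OF A])
    show "fun_space.dim (M ` A) = fun_space.dim A"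
    proof (rule dim_image_linear_injective[OF A M.add M.scale])
      fix f assume f: "f \<in> A" "M f = 0"
      show "f = 0"
      proof
        fix x
        have "(a \<bullet> x) * f x = 0" using f(2) by (simp add: M_def fun_eq_iff)
        then show "f x = 0 x" using a[of x] off[OF f(1), of x] by (cases "x \<in> Z") auto
      qed
    qed
  qed
  obtain D where D: "D \<subseteq> M ` A" "fun_space.independent D" "M ` A \<subseteq> fun_space.span D" "card D = fun_space.dim (M ` A)"
    using fun_space.basis_exists by blast
  have span_D: "fun_space.span D = M ` A" using D(3) fun_space.span_minimal[OF D(1) MA(1)] by blast
  have off_D: "f x = 0" if "f \<in> M ` A" "x \<notin> Z" for f x using that off by (auto simp: M_def)
  have "finite D"
    using fun_space.independent_span_bound[OF finite_span(1) D(2)] D(1) in_span off_D by blast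
  have trivial: "f = 0" if f: "f \<in> A" "f \<in> M ` A" for f
  proof -
    obtain g h where gh: "g \<in> E" "f = cut Z g" "h \<in> E" "f = M (cut Z h)"
      using f by (auto simp: A_def)
    have "w x * (f x)\<^sup>2 = w x * ((a \<bullet> x) * g x * h x)" if "x \<in> Z" for x
    proof -
      have "f x = g x" using that by (simp add: gh(2) cut_def)
      moreover have "f x = (a \<bullet> x) * h x" unfolding gh(4) using that by (simp add: M_def cut_def)
      ultimately show ?thesis by (simp add: power2_eq_square)
    qed
    then have "(\<Sum>x\<in>Z. w x * (f x)\<^sup>2) = (\<Sum>x\<in>Z. w x * ((a \<bullet> x) * g x * h x))"
      by (intro sum.cong refl)
    also have "\<dots> = 0" by (rule quad_odd_product[OF gh(1,3)])
    finally have "(\<Sum>x\<in>Z. w x * (f x)\<^sup>2) = 0" .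
    then have zero: "w x * (f x)\<^sup>2 = 0" if "x \<in> Z" for x
      using that finite_Z weight_pos_Z
      by (subst (asm) sum_nonneg_eq_0_iff) (auto simp: less_imp_le)
    have "f x = 0" for x
      using off[OF f(1), of x] zero[of x] weight_pos_Z[of x] by (cases "x \<in> Z") auto
    then show ?thesis by (simp add: fun_eq_iff)
  qed
  have indep: "fun_space.independent (C \<union> D)" and disj: "C \<inter> D = {}"
    using independent_Un_trivial_intersection[OF \<open>finite C\<close> C(2) \<open>finite D\<close> D(2)] trivial
    unfolding span_C span_D by blast+
  have CD_span: "C \<union> D \<subseteq> fun_space.span (\<delta> ` Z)"
    using C(1) D(1) in_span off off_D by blast
  have card_CD: "card (C \<union> D) = 2 * fun_space.dim A"
    using \<open>finite C\<close> \<open>finite D\<close> disj C(4) D(4) MA(2) by (simp add: card_Un_disjoint)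
  have upper: "2 * fun_space.dim A \<le> card Z"
    using fun_space.independent_span_bound[OF finite_span(1) indep CD_span] finite_span(2) card_CD by simp
  have lower: "fun_space.dim E \<le> fun_space.dim A + 1"
  proof -
    have "fun_space.dim (cut X ` E) = fun_space.dim E"
      using even_poly_determined_on_nodes by (intro dim_image_cut[OF subspace_even_polys]) blast
    moreover have "cut X ` E \<subseteq> fun_space.span (insert (\<delta> 0) C)"
    proof
      fix f assume "f \<in> cut X ` E"
      then obtain g where g: "g \<in> E" "f = cut X g" by blast
      have "f = (\<lambda>x. g 0 * \<delta> 0 x) + cut Z g"
      proof (rule ext)
        fix x
        show "f x = ((\<lambda>x. g 0 * \<delta> 0 x) + cut Z g) x"
          using zero_notin_Z by (cases "x = 0") (simp_all add: g(2) cut_def \<delta>_def in_X_iff)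
      qed
      moreover have "cut Z g \<in> fun_space.span C" using g(1) unfolding span_C A_def by blast
      then have "cut Z g \<in> fun_space.span (insert (\<delta> 0) C)"
        using fun_space.span_mono[of C "insert (\<delta> 0) C"] by blast
      moreover have "(\<lambda>x. g 0 * \<delta> 0 x) \<in> fun_space.span (insert (\<delta> 0) C)"
        by (intro fun_space.span_scale fun_space.span_base) auto
      ultimately show "f \<in> fun_space.span (insert (\<delta> 0) C)"
        by (simp only: fun_space.span_add)
    qed
    moreover have "card (insert (\<delta> 0) C) \<le> fun_space.dim A + 1"
      using card_insert_le_m1 \<open>finite C\<close> C(4) by (simp add: card_insert_if)
    ultimately show ?thesis
      using fun_space.dim_le_card[of "cut X ` E" "insert (\<delta> 0) C"] \<open>finite C\<close> by simp
  qed
  show "fun_space.dim (cut Z ` E) + 1 = fun_space.dim E"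
    using upper lower card_Z by (simp add: A_def)
  have "cut Z h \<in> fun_space.span (C \<union> D)"
  proof (rule ccontr)
    assume n: "cut Z h \<notin> fun_space.span (C \<union> D)"
    have "insert (cut Z h) (C \<union> D) \<subseteq> fun_space.span (\<delta> ` Z)"
      using CD_span in_span[of "cut Z h"] by (auto simp: cut_def)
    then have "card (insert (cut Z h) (C \<union> D)) \<le> card (\<delta> ` Z)"
      using fun_space.independent_span_bound[OF finite_span(1) fun_space.independent_insertI[OF n indep]] by simp
    moreover have "cut Z h \<notin> C \<union> D" using n fun_space.span_base by blast
    ultimately show False
      using card_CD lower card_Z finite_span(2) \<open>finite C\<close> \<open>finite D\<close> by simp
  qed
  then obtain u v where uv: "u \<in> A" "v \<in> M ` A" "cut Z h = u + v"
    unfolding fun_space.span_Un span_C span_D by blast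
  then obtain f g where fg: "f \<in> E" "u = cut Z f" "g \<in> E" "v = M (cut Z g)"
    by (auto simp: A_def)
  have "h z = f z + (a \<bullet> z) * g z" if "z \<in> Z" for z
    using fun_cong[OF uv(3), of z] that by (simp add: fg(2,4) M_def cut_def)
  then show "\<exists>f\<in>E. \<exists>g\<in>E. \<forall>z\<in>Z. h z = f z + (a \<bullet> z) * g z" using fg(1,3) by blast
qed

text \<open>Multiplication by a quotient of two linear forms preserves the restriction of \<open>E\<close>: the product of an
  element with any linear form is orthogonal to that restriction, so it lies in the complement, which consists
  of the products of \<open>E\<close> with the linear form \<open>a\<close>.\<close>

lemma exchange_linear_factor:
  assumes f: "f \<in> E"
  shows "\<exists>g\<in>E. \<forall>z\<in>Z. (a \<bullet> z) * g z = (c \<bullet> z) * f z"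
proof -
  obtain u g where ug: "u \<in> E" "g \<in> E" "\<And>z. z \<in> Z \<Longrightarrow> (c \<bullet> z) * f z = u z + (a \<bullet> z) * g z"
    using functions_on_Z[of "\<lambda>z. (c \<bullet> z) * f z"] by blast
  have "w z * (u z)\<^sup>2 = w z * ((c \<bullet> z) * f z * u z) - w z * ((a \<bullet> z) * g z * u z)" if "z \<in> Z" for z
    using ug(3)[OF that] by (simp add: algebra_simps power2_eq_square)
  then have "(\<Sum>z\<in>Z. w z * (u z)\<^sup>2) =
      (\<Sum>z\<in>Z. w z * ((c \<bullet> z) * f z * u z) - w z * ((a \<bullet> z) * g z * u z))"
    by (intro sum.cong refl)
  also have "\<dots> = 0"
    unfolding sum_subtractf by (simp only: quad_odd_product[OF f ug(1)] quad_odd_product[OF ug(2,1)])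
  finally have "(\<Sum>z\<in>Z. w z * (u z)\<^sup>2) = 0" .
  then have zero: "w z * (u z)\<^sup>2 = 0" if "z \<in> Z" for z
    using that finite_Z weight_pos_Z
    by (subst (asm) sum_nonneg_eq_0_iff) (auto simp: less_imp_le)
  have "u z = 0" if "z \<in> Z" for z using zero[OF that] weight_pos_Z[OF that] by simp
  then show ?thesis using ug by auto
qed

end

text \<open>Restriction of \<open>E\<close> to \<open>Z\<close> loses one dimension, so some nonzero element vanishes on \<open>Z\<close>; its value
  at the origin cannot be zero too, since the nodes determine it.\<close>

lemma polynomial_at_origin:
  obtains f where "f \<in> E" "f 0 = 1" "\<And>z. z \<in> Z \<Longrightarrow> f z = 0"
proof -
  obtain a where a: "\<And>z. z \<in> Z \<Longrightarrow> a \<bullet> z \<noteq> 0"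
    using exists_vector_not_orthogonal[OF finite_Z zero_notin_Z] by blast
  have "\<exists>f\<in>E. (\<forall>z\<in>Z. f z = 0) \<and> f \<noteq> (\<lambda>x. 0)"
  proof (rule ccontr)
    assume "\<not> ?thesis"
    then have "fun_space.dim (cut Z ` E) = fun_space.dim E"
      by (intro dim_image_cut[OF subspace_even_polys]) blast
    then show False using dim_restricted[OF a] by simp
  qed
  then obtain f where f: "f \<in> E" "\<And>z. z \<in> Z \<Longrightarrow> f z = 0" "f \<noteq> (\<lambda>x. 0)" by blast
  have "f 0 \<noteq> 0"
  proof
    assume "f 0 = 0"
    then have "f x = 0" if "x \<in> X" for x using that f(2)[of x] by (auto simp: in_X_iff)
    from even_poly_determined_on_nodes[OF f(1) this] show False using f(3) by blast
  qed
  show ?thesis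
  proof (rule that)
    show "(\<lambda>x. 1 / f 0 * f x) \<in> E" by (rule even_polys_scale[OF f(1)])
    show "1 / f 0 * f 0 = 1" using \<open>f 0 \<noteq> 0\<close> by simp
    show "1 / f 0 * f z = 0" if "z \<in> Z" for z using f(2)[OF that] by simp
  qed
qed

text \<open>Reproducing at a node \<open>z \<in> Z\<close> a polynomial that vanishes at all nodes but the origin shows that
  \<open>even_kernel k z 0\<close> is zero. This value is a positive multiple of \<open>rev_poly k (cheb k) z\<close>, since zonal kernels
  of positive degree vanish at the origin.\<close>

lemma node_radius_root:
  assumes "z \<in> Z"
  shows "poly (cheb k) (1 / (norm z)\<^sup>2) = 0"
proof -
  obtain f where f: "f \<in> E" "f 0 = 1" "\<And>z. z \<in> Z \<Longrightarrow> f z = 0" 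
    using polynomial_at_origin by blast
  have "0 = quad (\<lambda>y. even_kernel k z y * f y)"
    using even_kernel_reproducing[OF f(1), of z] f(3)[OF assms] by simp
  also have "\<dots> = w 0 * even_kernel k z 0"
    using f(2,3) by (simp add: quad_split)
  finally have "even_kernel k z 0 = 0" using weight_pos[OF zero_in_X] by simp
  then have "rev_poly k (cheb k) z = 0"
    using sphere_area_pos[where 'n='n] by (auto simp: even_kernel_at_0)
  moreover have "z \<noteq> 0" using assms zero_notin_Z by blast
  ultimately show ?thesis by (simp add: rev_poly_eq degree_cheb)
qed

text \<open>The roots of \<open>q\<close> are those of \<open>cheb k\<close> except one, so \<open>q\<close> separates one sphere from
  the other spheres that carry nodes.\<close>

lemma layer_polynomial:
  assumes "x \<in> Z"
  obtains q where "degree q < k" "\<And>z. z \<in> Z \<Longrightarrow> poly q (1 / (norm z)\<^sup>2) = 0 \<longleftrightarrow> norm z \<noteq> norm x"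
proof -
  define R where "R = {s. poly (cheb k) s = 0}"
  define s where "s = 1 / (norm x)\<^sup>2"
  define q where "q = (\<Prod>t\<in>R - {s}. [:- t, 1:])"
  have ne: "cheb k \<noteq> 0" using coeff_cheb[of k] by auto
  have "finite R" "card R \<le> k"
    using poly_roots_finite[OF ne] card_poly_roots_bound[OF ne] by (simp_all add: R_def degree_cheb)
  moreover have "s \<in> R" using node_radius_root[OF assms] by (simp add: R_def s_def)
  ultimately have "card (R - {s}) < k" by (metis card_Diff1_less less_le_trans)
  moreover have "degree q \<le> card (R - {s})"
    unfolding q_def using degree_prod_sum_le[of "R - {s}" "\<lambda>t. [:- t, 1:]"] \<open>finite R\<close> by (simp add: o_def)
  moreover have "poly q (1 / (norm z)\<^sup>2) = 0 \<longleftrightarrow> norm z \<noteq> norm x" if "z \<in> Z" for z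
  proof -
    have "poly q (1 / (norm z)\<^sup>2) = 0 \<longleftrightarrow> 1 / (norm z)\<^sup>2 \<in> R - {s}"
      using \<open>finite R\<close> by (auto simp: q_def poly_prod)
    also have "\<dots> \<longleftrightarrow> 1 / (norm z)\<^sup>2 \<noteq> s" using node_radius_root[OF that] by (auto simp: R_def)
    also have "\<dots> \<longleftrightarrow> (norm z)\<^sup>2 \<noteq> (norm x)\<^sup>2"
      using that assms zero_notin_Z by (auto simp: s_def)
    also have "\<dots> \<longleftrightarrow> norm z \<noteq> norm x" by (simp add: power2_eq_iff_nonneg)
    finally show ?thesis .
  qed
  ultimately show ?thesis using that[of q] by simp
qed

text \<open>Start with a polynomial in \<open>(norm y)\<^sup>2\<close> that vanishes at all nodes of \<open>Z\<close> off the sphere through \<open>x\<close>. Every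
  other node \<open>y\<close> on that sphere, except \<open>- x\<close>, can be turned into a zero: exchange the linear factor \<open>a\<close> for
  a linear form that vanishes at \<open>y\<close> but not at \<open>x\<close>.\<close>

lemma node_polynomial:
  assumes x: "x \<in> Z"
  obtains f where "f \<in> E" "f x = 1" "\<And>y. y \<in> X \<Longrightarrow> y \<noteq> x \<Longrightarrow> y \<noteq> - x \<Longrightarrow> f y = 0"
proof -
  obtain a where a: "\<And>z. z \<in> Z \<Longrightarrow> a \<bullet> z \<noteq> 0"
    using exists_vector_not_orthogonal[OF finite_Z zero_notin_Z] by blast
  obtain q where q: "degree q < k" "\<And>z. z \<in> Z \<Longrightarrow> poly q (1 / (norm z)\<^sup>2) = 0 \<longleftrightarrow> norm z \<noteq> norm x"
    using layer_polynomial[OF x] by blast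
  have "\<exists>f\<in>E. f x \<noteq> 0 \<and> (\<forall>y\<in>Z. norm y \<noteq> norm x \<or> y \<in> Y \<longrightarrow> f y = 0)"
    if "finite Y" "Y \<subseteq> {y \<in> Z. norm y = norm x \<and> y \<noteq> x \<and> y \<noteq> - x}" for Y
    using that
  proof (induction Y rule: finite_induct)
    case empty
    define f :: "real ^ 'n \<Rightarrow> real" where "f = rev_poly (k - 1) q"
    have "(\<lambda>_ :: real ^ 'n. 1) \<in> forms (2 * 0)" using forms_const[of 1] by simp
    from rev_poly_in_even_polys[OF this, of "k - 1" "2 * k" q] have "f \<in> E" by (simp add: f_def)
    moreover have "f z = 0 \<longleftrightarrow> norm z \<noteq> norm x" if "z \<in> Z" for z
    proof -
      have "z \<noteq> 0" "degree q \<le> k - 1" using that zero_notin_Z q(1) by auto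
      then show ?thesis using q(2)[OF that] by (simp add: f_def rev_poly_eq del: One_nat_def)
    qed
    ultimately show ?case using x by auto
  next
    case (insert y Y)
    then obtain f where f: "f \<in> E" "f x \<noteq> 0" "\<And>z. z \<in> Z \<Longrightarrow> norm z \<noteq> norm x \<or> z \<in> Y \<Longrightarrow> f z = 0"
      by auto
    \<comment> \<open>a multiple of the component of \<open>x\<close> orthogonal to \<open>y\<close>\<close>
    define c where "c = (y \<bullet> y) *\<^sub>R x - (x \<bullet> y) *\<^sub>R y"
    have y: "y \<in> Z" "norm y = norm x" "y \<noteq> x" "y \<noteq> - x" using insert.prems by auto
    have "\<bar>x \<bullet> y\<bar> \<noteq> norm x * norm y"
    proof
      assume "\<bar>x \<bullet> y\<bar> = norm x * norm y"
      then have "norm x *\<^sub>R y = norm y *\<^sub>R x \<or> norm x *\<^sub>R y = - norm y *\<^sub>R x"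
        by (simp only: norm_cauchy_schwarz_abs_eq)
      then have "norm x *\<^sub>R y = norm x *\<^sub>R x \<or> norm x *\<^sub>R y = norm x *\<^sub>R (- x)"
        using y(2) by simp
      moreover have "norm x \<noteq> 0" using x zero_notin_Z by auto
      ultimately show False using y(3,4) by (simp only: scaleR_cancel_left) blast
    qed
    then have "(x \<bullet> y)\<^sup>2 \<noteq> (norm x * norm y)\<^sup>2"
      by (auto simp: power2_eq_iff abs_mult)
    moreover have "c \<bullet> x = (norm x * norm y)\<^sup>2 - (x \<bullet> y)\<^sup>2"
      unfolding c_def inner_diff_left inner_scaleR_left power_mult_distrib power2_norm_eq_inner
      by (simp add: inner_commute[of y x] power2_eq_square)
    moreover have "c \<bullet> y = 0"
      unfolding c_def inner_diff_left inner_scaleR_left by simp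
    ultimately have c: "c \<bullet> x \<noteq> 0" "c \<bullet> y = 0" by simp_all
    obtain g where g: "g \<in> E" "\<And>z. z \<in> Z \<Longrightarrow> (a \<bullet> z) * g z = (c \<bullet> z) * f z"
      using exchange_linear_factor[OF a f(1), of c] by blast
    have "g x \<noteq> 0" using g(2)[OF x] c(1) f(2) by auto
    moreover have "g z = 0" if "z \<in> Z" "norm z \<noteq> norm x \<or> z \<in> insert y Y" for z
    proof -
      have "(a \<bullet> z) * g z = 0"
        unfolding g(2)[OF that(1)] using that f(3)[OF that(1)] c(2) by auto
      then show ?thesis using a[OF that(1)] by simp
    qed
    ultimately show ?case using g(1) by blast
  qed
  from this[of "{y \<in> Z. norm y = norm x \<and> y \<noteq> x \<and> y \<noteq> - x}"]
  obtain f where f: "f \<in> E" "f x \<noteq> 0" "\<And>y. y \<in> Z \<Longrightarrow> y \<noteq> x \<Longrightarrow> y \<noteq> - x \<Longrightarrow> f y = 0"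
    using finite_Z by auto
  obtain g where g: "g \<in> E" "g 0 = 1" "\<And>z. z \<in> Z \<Longrightarrow> g z = 0" 
    using polynomial_at_origin by blast
  \<comment> \<open>\<open>g\<close> corrects the value at the origin and leaves the values on \<open>Z\<close> unchanged\<close>
  define h where "h = (\<lambda>y. 1 / f x * (f y + (- f 0) * g y))"
  have "h \<in> E" unfolding h_def by (intro even_polys_scale even_polys_add f(1) g(1))
  moreover have "h x = 1" using f(2) g(3)[OF x] by (simp add: h_def)
  moreover have "h y = 0" if "y \<in> X" "y \<noteq> x" "y \<noteq> - x" for y
    using that f(3) g(2,3) by (auto simp: h_def in_X_iff)
  ultimately show ?thesis using that by blast
qed

text \<open>If \<open>x\<close> had no antipode of the same weight, the odd polynomial \<open>(x \<bullet> y) * (f y)\<^sup>2\<close>, with \<open>f\<close>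
  vanishing at all other nodes, would have a nonzero quadrature sum.\<close>

lemma antipodal:
  assumes x: "x \<in> Z"
  shows "- x \<in> Z" "w (- x) = w x"
proof -
  obtain f where f: "f \<in> E" "f x = 1" "\<And>y. y \<in> X \<Longrightarrow> y \<noteq> x \<Longrightarrow> y \<noteq> - x \<Longrightarrow> f y = 0"
    using node_polynomial[OF x] by blast
  have f': "f (- x) = 1" using f(1,2) by (simp add: even_polys_def)
  have "x \<noteq> 0" using x zero_notin_Z by blast
  then have "x \<noteq> - x" by (rule nonzero_neq_minus)
  have 0: "(\<Sum>y\<in>Z. w y * ((x \<bullet> y) * f y * f y)) = 0" by (rule quad_odd_product[OF f(1,1)])
  have "(\<Sum>y\<in>Z. w y * ((x \<bullet> y) * f y * f y)) = (\<Sum>y\<in>Z \<inter> {x, - x}. w y * (x \<bullet> y))"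
    using finite_Z f f' by (intro sum.mono_neutral_cong_right) (auto simp: in_X_iff)
  then have s: "(\<Sum>y\<in>Z \<inter> {x, - x}. w y * (x \<bullet> y)) = 0" using 0 by simp
  show "- x \<in> Z"
  proof (rule ccontr)
    assume "- x \<notin> Z"
    then have "Z \<inter> {x, - x} = {x}" using x by blast
    then show False using s weight_pos_Z[OF x] \<open>x \<noteq> 0\<close> by simp
  qed
  then have "Z \<inter> {x, - x} = {x, - x}" using x by blast
  then have "(w x - w (- x)) * (x \<bullet> x) = 0" using s \<open>x \<noteq> - x\<close> by (simp add: algebra_simps)
  then show "w (- x) = w x" using \<open>x \<noteq> 0\<close> by simp
qed

text \<open>Apply the quadrature to the product of \<open>even_kernel k x\<close> and the polynomial that is \<open>1\<close> at \<open>x\<close> and \<open>- x\<close>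
  and \<open>0\<close> at the other nodes.\<close>

lemma node_weight:
  assumes x: "x \<in> Z"
  shows "2 * w x * even_kernel k x x = 1"
proof -
  obtain f where f: "f \<in> E" "f x = 1" "\<And>y. y \<in> X \<Longrightarrow> y \<noteq> x \<Longrightarrow> y \<noteq> - x \<Longrightarrow> f y = 0"
    using node_polynomial[OF x] by blast
  have f': "f (- x) = 1" using f(1,2) by (simp add: even_polys_def)
  have "x \<noteq> 0" using x zero_notin_Z by blast
  then have "x \<noteq> - x" by (rule nonzero_neq_minus)
  have "1 = quad (\<lambda>y. even_kernel k x y * f y)"
    using even_kernel_reproducing[OF f(1), of x] f(2) by simp
  also have "\<dots> = (\<Sum>y\<in>{x, - x}. w y * even_kernel k x y)"
    unfolding quad_def using finite_X f f' x antipodal(1)[OF x]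
    by (intro sum.mono_neutral_cong_right) (auto simp: in_X_iff)
  also have "\<dots> = w x * even_kernel k x x + w (- x) * even_kernel k x (- x)"
    using \<open>x \<noteq> - x\<close> by simp
  also have "even_kernel k x (- x) = even_kernel k x x"
    using even_kernel_in_even_polys[of k x] by (simp add: even_polys_def)
  finally show ?thesis by (simp add: antipodal(2)[OF x])
qed

end

section \<open>Arithmetic of the squared radii\<close>

abbreviation int_eval :: "int poly \<Rightarrow> real \<Rightarrow> real" where
  "int_eval q y \<equiv> poly (map_poly of_int q) y"

lemma int_eval_add: "int_eval (p + q) y = int_eval p y + int_eval q y"
proof -
  have "map_poly of_int (p + q) = (map_poly of_int p + map_poly of_int q :: real poly)"
    by (rule poly_eqI) (simp add: coeff_map_poly)
  then show ?thesis by simp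
qed

lemma int_eval_mult: "int_eval (p * q) y = int_eval p y * int_eval q y"
proof -
  have "map_poly of_int (p * q) = (map_poly of_int p * map_poly of_int q :: real poly)"
    by (rule poly_eqI) (simp add: coeff_map_poly coeff_mult)
  then show ?thesis by simp
qed

lemma int_eval_smult: "int_eval (smult c p) y = of_int c * int_eval p y"
proof -
  have "map_poly of_int (smult c p) = (smult (of_int c) (map_poly of_int p) :: real poly)"
    by (rule poly_eqI) (simp add: coeff_map_poly)
  then show ?thesis by simp
qed

text \<open>By pseudo-division the nonzero polynomial of least degree that vanishes at \<open>y\<close> divides
  a multiple of \<open>m\<close>; by Gauss's lemma its primitive part divides \<open>m\<close> itself.\<close>

lemma irreducible_int_poly_minimal_degree:
  fixes m q :: "int poly" and y :: real
  assumes m: "irreducible m" "int_eval m y = 0"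
    and q: "int_eval q y = 0" "degree q < degree m"
  shows "q = 0"
proof (rule ccontr)
  assume "q \<noteq> 0"
  define P where "P r \<longleftrightarrow> r \<noteq> 0 \<and> int_eval r y = 0" for r :: "int poly"
  have "P q" using q \<open>q \<noteq> 0\<close> by (simp add: P_def)
  then obtain r where r: "P r" "\<And>r'. P r' \<Longrightarrow> degree r \<le> degree r'"
    using ex_has_least_nat[of P q degree] by blast
  have r0: "r \<noteq> 0" "int_eval r y = 0" using r(1) by (simp_all add: P_def)
  obtain t s where ts: "pseudo_divmod m r = (t, s)" by fastforce
  define c where "c = coeff r (degree r) ^ (Suc (degree m) - degree r)"
  have "c \<noteq> 0" using r0(1) by (simp add: c_def)
  have div: "smult c m = r * t + s" and s: "s = 0 \<or> degree s < degree r"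
    using pseudo_divmod[OF r0(1) ts] by (auto simp: c_def)
  have "int_eval (smult c m) y = int_eval (r * t + s) y" by (simp only: div)
  then have "int_eval s y = 0"
    by (simp add: int_eval_add int_eval_mult int_eval_smult m(2) r0(2))
  have "s = 0"
  proof (rule ccontr)
    assume "s \<noteq> 0"
    then have "P s" using \<open>int_eval s y = 0\<close> by (simp add: P_def)
    then show False using r(2)[of s] s \<open>s \<noteq> 0\<close> by simp
  qed
  then have "primitive_part (smult c m) = primitive_part r * primitive_part t"
    using div by (simp add: primitive_part_mult)
  moreover have "primitive_part (smult c m) = smult (unit_factor c) (primitive_part m)"
    by (rule primitive_part_smult)
  moreover have "sgn c * sgn c = 1" using \<open>c \<noteq> 0\<close> by (simp add: sgn_if)
  then have "primitive_part m = smult (sgn c) (smult (sgn c) (primitive_part m))"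
    by simp
  ultimately have "smult (sgn c) (primitive_part r * primitive_part t) = primitive_part m"
    by simp
  then have "primitive_part r dvd primitive_part m"
    by (metis dvd_triv_left mult_smult_right)
  also have "primitive_part m dvd m"
    by (metis content_times_primitive_part dvd_refl dvd_smult)
  finally obtain u where u: "m = primitive_part r * u" by (elim dvdE)
  have unit: "degree v = 0" if "v dvd 1" for v :: "int poly"
    using that by (auto simp: is_unit_poly_iff)
  have "degree r \<noteq> 0"
  proof
    assume "degree r = 0"
    then obtain b where "r = [:b:]" by (rule degree_eq_zeroE)
    then show False using r0 by (simp add: map_poly_pCons)
  qed
  then have "degree u = 0"
    using irreducibleD[OF m(1) u] unit[of u] unit[of "primitive_part r"] by auto
  moreover have "m \<noteq> 0" using m(1) by auto
  ultimately have "degree m = degree r"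
    using u r0(1) by (auto simp: degree_mult_eq)
  then show False using r(2)[OF \<open>P q\<close>] q(2) by simp
qed

text \<open>Only factorizations into two nonconstant factors matter: by monicity a constant factor is a unit.\<close>

lemma irreducible_monic_int_polyI:
  fixes m :: "int poly"
  assumes "lead_coeff m = 1" "degree m > 0"
    and "\<And>a b. m = a * b \<Longrightarrow> 0 < degree a \<Longrightarrow> degree a \<le> degree b \<Longrightarrow> False"
  shows "irreducible m"
proof (rule irreducibleI)
  show "m \<noteq> 0" using assms(2) by auto
  show "\<not> m dvd 1" using assms(2) by (auto simp: is_unit_poly_iff)
  have unit: "a dvd 1" if eq: "m = a * b" and deg: "degree a = 0" for a b
  proof -
    obtain c where c: "a = [:c:]" using deg by (rule degree_eq_zeroE)
    have "lead_coeff a * lead_coeff b = 1" using assms(1) unfolding eq lead_coeff_mult .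
    then have "c * lead_coeff b = 1" by (simp add: c)
    then have "c dvd 1" by (metis dvd_triv_left)
    then show ?thesis using c by (simp add: is_unit_const_poly_iff)
  qed
  fix a b assume ab: "m = a * b"
  then have ba: "m = b * a" by (simp add: mult.commute)
  consider "degree a = 0" | "degree b = 0" | "0 < degree a" "degree a \<le> degree b" | "0 < degree b" "degree b \<le> degree a"
    by linarith
  then show "a dvd 1 \<or> b dvd 1"
    using unit[OF ab] unit[OF ba] assms(3)[OF ab] assms(3)[OF ba] by cases auto
qed

text \<open>This polynomial and the next one are \<open>cheb 3\<close> and \<open>cheb 5\<close> in the variable \<open>y = 4 * s\<close>; their roots are the
  conjugates of \<open>4 * (cos (\<pi> / 7))\<^sup>2\<close> and \<open>4 * (cos (\<pi> / 11))\<^sup>2\<close>. Both are irreducible modulo \<open>2\<close>, so comparing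
  the parities of the coefficients rules out a factorization.\<close>

lemma irreducible_cubic: "irreducible [:-1, 6, -5, 1 :: int:]"
proof (rule irreducible_monic_int_polyI)
  fix a b :: "int poly"
  assume ab: "[:-1, 6, -5, 1:] = a * b" and deg: "0 < degree a" "degree a \<le> degree b"
  then have "a \<noteq> 0" "b \<noteq> 0" by auto
  then have "degree a + degree b = 3" using arg_cong[OF ab, of degree] by (simp add: degree_mult_eq)
  then have d: "degree a \<le> 1" "degree b \<le> 2" using deg by auto
  then have z: "coeff a 2 = 0" "coeff a 3 = 0" "coeff b 3 = 0" by (auto intro: coeff_eq_0)
  have "even (coeff [:-1, 6, -5, 1 :: int:] i) \<longleftrightarrow> even (\<Sum>j\<le>i. coeff a j * coeff b (i - j))" for i
    unfolding ab coeff_mult ..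
  from this[of 0] this[of 1] this[of 2] this[of 3] z show False
    by (auto simp: eval_nat_numeral)
qed auto

lemma irreducible_quintic: "irreducible [:-1, 15, -35, 28, -9, 1 :: int:]"
proof (rule irreducible_monic_int_polyI)
  fix a b :: "int poly"
  assume ab: "[:-1, 15, -35, 28, -9, 1:] = a * b" and deg: "0 < degree a" "degree a \<le> degree b"
  then have "a \<noteq> 0" "b \<noteq> 0" by auto
  then have "degree a + degree b = 5" using arg_cong[OF ab, of degree] by (simp add: degree_mult_eq)
  have parity: "even (coeff [:-1, 15, -35, 28, -9, 1 :: int:] i) \<longleftrightarrow>
      even (\<Sum>j\<le>i. coeff a j * coeff b (i - j))" for i
    unfolding ab coeff_mult ..
  consider "degree a = 1" "degree b = 4" | "degree a = 2" "degree b = 3"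
    using deg \<open>degree a + degree b = 5\<close> by linarith
  then show False
  proof cases
    case 1
    then have z: "coeff a 2 = 0" "coeff a 3 = 0" "coeff a 4 = 0" "coeff a 5 = 0" "coeff b 5 = 0"
      by (simp_all add: coeff_eq_0)
    show False using parity[of 0] parity[of 1] parity[of 2] parity[of 3] z
      parity[of 4] parity[of 5] by (simp add: eval_nat_numeral)
  next
    case 2
    then have z: "coeff a 3 = 0" "coeff a 4 = 0" "coeff a 5 = 0" "coeff b 4 = 0" "coeff b 5 = 0"
      by (simp_all add: coeff_eq_0)
    show False using parity[of 0] parity[of 1] parity[of 2] parity[of 3] z
      parity[of 4] parity[of 5] by (simp add: eval_nat_numeral)
  qed
qed auto

section \<open>Counting the nodes on a sphere\<close>

context minimal_cubature
begin

text \<open>The nodes on one sphere have equal weights, which the diagonal of the kernel determines. Their total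
  weight is also known: on radial polynomials that vanish at the origin, the formula is a Gauss formula in
  \<open>s = 1 / (norm x)\<^sup>2\<close> with nodes at roots of \<open>cheb k\<close>, and a Gauss weight is the reciprocal of a sum of squares of
  the orthogonal polynomials. The number of nodes on the sphere is the quotient.\<close>

lemma layer_count:
  assumes x: "x \<in> Z"
  shows "2 * (\<Sum>a\<le>k. fun_space.dim (forms (2 * (k - a)) :: (real ^ 'n \<Rightarrow> real) set) *
      (poly (cheb a) (1 / (norm x)\<^sup>2))\<^sup>2) =
    card {z \<in> Z. norm z = norm x} * (\<Sum>a\<le>k. (poly (cheb a) (1 / (norm x)\<^sup>2))\<^sup>2)"
proof -
  define s where "s = 1 / (norm x)\<^sup>2"
  define S where "S = (\<Sum>a\<le>k. fun_space.dim (forms (2 * (k - a)) :: (real ^ 'n \<Rightarrow> real) set) * (poly (cheb a) s)\<^sup>2)"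
  define G where "G = (\<Sum>a\<le>k. (poly (cheb a) s)\<^sup>2)"
  define layer where "layer = {z \<in> Z. norm z = norm x}"
  define \<sigma> where "\<sigma> = sphere_area TYPE('n)"
  have \<sigma>: "\<sigma> > 0" unfolding \<sigma>_def by (rule sphere_area_pos)
  have x0: "x \<noteq> 0" using x zero_notin_Z by blast
  have kernel: "even_kernel k z z = 4 / pi * norm x ^ (4 * k) / \<sigma> * S" if "z \<in> layer" for z
  proof -
    have z: "z \<noteq> 0" "norm z = norm x" using that zero_notin_Z by (auto simp: layer_def)
    show ?thesis unfolding even_kernel_diagonal[OF z(1)] by (simp add: z(2) S_def s_def \<sigma>_def)
  qed
  have weight: "w z = w x" if "z \<in> layer" for z
  proof -
    have "x \<in> layer" using x by (simp add: layer_def)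
    then have "even_kernel k z z = even_kernel k x x" using kernel[OF that] kernel[of x] by simp
    moreover have "2 * w z * even_kernel k z z = 1" using that by (intro node_weight) (simp add: layer_def)
    moreover have "2 * w x * even_kernel k x x = 1" by (rule node_weight[OF x])
    ultimately have "2 * w z * even_kernel k x x = 2 * w x * even_kernel k x x" "even_kernel k x x \<noteq> 0"
      by (simp, force)
    then show ?thesis by simp
  qed
  obtain q where q: "degree q < k" "\<And>z. z \<in> Z \<Longrightarrow> poly q (1 / (norm z)\<^sup>2) = 0 \<longleftrightarrow> norm z \<noteq> norm x"
    using layer_polynomial[OF x] by blast
  have qs: "poly q s \<noteq> 0" using q(2)[OF x] by (simp add: s_def)
  \<comment> \<open>\<open>C\<close> reproduces values at \<open>s\<close> of polynomials of degree below \<open>k\<close>; the factor \<open>q\<close> removes the other spheres.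
    The product has degree below \<open>2 * k\<close>, so the node at the origin does not contribute.\<close>
  define C where "C = (\<Sum>a\<le>k - 1. smult (poly (cheb a) s) (cheb a))"
  have deg_C: "degree C \<le> k - 1"
    unfolding C_def by (intro degree_sum_le) (auto intro: order_trans[OF degree_smult_le] simp: degree_cheb)
  have deg: "degree (C * q) < 2 * k"
    using degree_mult_le[of C q] deg_C q(1) by linarith
  have poly_C: "poly C s = G"
  proof -
    have "{..k} = insert k {..k - 1}" using k_pos by auto
    then have "G = (poly (cheb k) s)\<^sup>2 + (\<Sum>a\<le>k - 1. (poly (cheb a) s)\<^sup>2)"
      using k_pos by (simp add: G_def)
    then show ?thesis
      using node_radius_root[OF x] by (simp add: C_def poly_sum s_def power2_eq_square)
  qed
  have radial_Cq: "radial (C * q) = pi / 4 * poly q s"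
  proof -
    have "radial (C * q) = (\<Sum>a\<le>k - 1. poly (cheb a) s * radial (q * cheb a))"
      by (simp add: C_def sum_distrib_right radial_sum radial_smult mult.commute[of q])
    also have "\<dots> = pi / 4 * (\<Sum>a\<le>k - 1. 4 / pi * radial (q * cheb a) * poly (cheb a) s)"
      by (simp add: sum_distrib_left mult.commute)
    also have "(\<Sum>a\<le>k - 1. 4 / pi * radial (q * cheb a) * poly (cheb a) s) = poly q s"
    proof -
      have "degree q \<le> k - 1" using q(1) by simp
      from arg_cong[OF cheb_expansion[OF this], of "\<lambda>p. poly p s"] show ?thesis
        by (simp add: poly_sum)
    qed
    finally show ?thesis .
  qed
  have "(\<lambda>_ :: real ^ 'n. 1) \<in> forms (2 * 0)" using forms_const[of 1] by simp
  from quad_rev_poly[OF this, of "C * q" "2 * k"] deg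
  have "quad (rev_poly (2 * k) (C * q)) = \<sigma> * (pi / 4 * poly q s)"
    by (simp add: \<sigma>_def radial_Cq monom_0 flip: one_pCons)
  moreover have "quad (rev_poly (2 * k) (C * q)) =
      (\<Sum>z\<in>Z. if norm z = norm x then w x * (norm x ^ (4 * k) * (G * poly q s)) else 0)"
  proof -
    have "rev_poly (2 * k) (C * q) (0 :: real ^ 'n) = 0"
      using deg by (simp add: rev_poly_at_0 coeff_eq_0)
    moreover have "w z * rev_poly (2 * k) (C * q) z =
        (if norm z = norm x then w x * (norm x ^ (4 * k) * (G * poly q s)) else 0)" if z: "z \<in> Z" for z
    proof -
      have z0: "z \<noteq> 0" using z zero_notin_Z by blast
      have "rev_poly (2 * k) (C * q) z =
          norm z ^ (4 * k) * (poly C (1 / (norm z)\<^sup>2) * poly q (1 / (norm z)\<^sup>2))"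
        using deg z0 by (simp add: rev_poly_eq)
      then show ?thesis
        using q(2)[OF z] weight[of z] z poly_C by (simp add: layer_def s_def)
    qed
    ultimately show ?thesis by (simp add: quad_split)
  qed
  moreover have "(\<Sum>z\<in>Z. if norm z = norm x then w x * (norm x ^ (4 * k) * (G * poly q s)) else 0) =
      card layer * (w x * (norm x ^ (4 * k) * (G * poly q s)))"
    using finite_Z by (simp add: sum.If_cases layer_def Int_def)
  ultimately have "(card layer * (w x * (norm x ^ (4 * k) * G))) * poly q s = (\<sigma> * (pi / 4)) * poly q s"
    by (simp add: mult_ac)
  then have eq1: "card layer * (w x * norm x ^ (4 * k) * G) = \<sigma> * (pi / 4)"
    using qs by (simp add: mult_ac)
  have "x \<in> layer" using x by (simp add: layer_def)
  then have "2 * w x * (4 / pi * norm x ^ (4 * k) / \<sigma> * S) = 1"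
    using node_weight[OF x] kernel by metis
  then have eq2: "2 * (w x * norm x ^ (4 * k)) * S = \<sigma> * (pi / 4)"
    using \<sigma> by (simp add: field_simps)
  have "(w x * norm x ^ (4 * k)) * (2 * S) = 2 * (w x * norm x ^ (4 * k)) * S"
    by (simp only: mult_ac)
  also have "\<dots> = card layer * (w x * norm x ^ (4 * k) * G)" by (simp only: eq1 eq2)
  also have "\<dots> = (w x * norm x ^ (4 * k)) * (card layer * G)" by (simp only: mult_ac)
  finally have "(w x * norm x ^ (4 * k)) * (2 * S) = (w x * norm x ^ (4 * k)) * (card layer * G)" .
  moreover have "w x * norm x ^ (4 * k) \<noteq> 0" using weight_pos_Z[OF x] x0 by simp
  ultimately have "2 * S = card layer * G" by (simp only: mult_cancel_left) blast
  then show ?thesis by (simp add: S_def G_def layer_def s_def)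
qed

lemma Z_nonempty: "Z \<noteq> {}"
proof
  assume "Z = {}"
  have "(\<lambda>x :: real ^ 'n. (norm x)\<^sup>2) \<in> E"
    by (rule forms_in_even_polys[where j = 1]) (use forms_norm_sq k_pos in auto)
  moreover have "(norm x)\<^sup>2 = 0" if "x \<in> X" for x
    using that \<open>Z = {}\<close> by (simp add: in_X_iff)
  ultimately have "(norm (axis undefined 1 :: real ^ 'n))\<^sup>2 = 0"
    by (rule even_poly_determined_on_nodes)
  then show False by simp
qed

end

text \<open>Multiplication by the squared norm embeds \<open>forms 2\<close> in \<open>forms 4\<close>, and the image does not contain
  every fourth power of a coordinate.\<close>

lemma dim_forms_2_less_4:
  assumes "CARD('n::finite) \<ge> 2"
  shows "fun_space.dim (forms 2 :: (real ^ 'n \<Rightarrow> real) set) < fun_space.dim (forms 4 :: (real ^ 'n \<Rightarrow> real) set)"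
proof -
  define T where "T f = (\<lambda>x. (norm x)\<^sup>2 * f x)" for f :: "real ^ 'n \<Rightarrow> real"
  have add: "T (f + g) = T f + T g" and scale: "T (\<lambda>x. c * f x) = (\<lambda>x. c * T f x)" for f g c
    by (auto simp: T_def fun_eq_iff algebra_simps)
  interpret T: Vector_Spaces.linear "\<lambda>(c::real) (f :: real ^ 'n \<Rightarrow> real) x. c * f x" "\<lambda>(c::real) (f :: real ^ 'n \<Rightarrow> real) x. c * f x" T
    by unfold_locales (auto simp: add scale)
  have "fun_space.dim (T ` forms 2) = fun_space.dim (forms 2 :: (real ^ 'n \<Rightarrow> real) set)"
  proof (rule dim_image_linear_injective[OF subspace_forms add scale])
    fix f :: "real ^ 'n \<Rightarrow> real" assume f: "f \<in> forms 2" "T f = 0"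
    have "f x = 0" if "norm x = 1" for x using fun_cong[OF f(2), of x] that by (simp add: T_def)
    from forms_vanishing[OF f(1) this] show "f = 0" by (simp add: fun_eq_iff)
  qed
  moreover have sub: "T ` forms 2 \<subseteq> forms 4"
    using forms_norm_mult[of _ 1 1] by (auto simp: T_def)
  obtain f :: "real ^ 'n \<Rightarrow> real" where f: "f \<in> forms 4" "f \<notin> T ` forms 2"
    using quartic_not_multiple_of_norm[OF assms] by (auto simp: T_def)
  obtain B where B: "B \<subseteq> T ` forms 2" "fun_space.independent B" "T ` forms 2 \<subseteq> fun_space.span B"
      "card B = fun_space.dim (T ` forms 2)"
    using fun_space.basis_exists by blast
  have "fun_space.span B \<subseteq> T ` forms 2"
    by (rule fun_space.span_minimal[OF B(1) T.subspace_image[OF subspace_forms]])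
  then have "f \<notin> fun_space.span B" using f(2) by blast
  then have indep: "fun_space.independent (insert f B)"
    using B(2) by (rule fun_space.independent_insertI)
  have "insert f B \<subseteq> fun_space.span (form_basis 4)"
    using B(1) sub f(1) unfolding span_form_basis by blast
  from fun_space.independent_span_bound[OF finite_form_basis indep this]
  have "finite (insert f B)" "card (insert f B) \<le> card (form_basis 4 :: (real ^ 'n \<Rightarrow> real) set)"
    by auto
  moreover have "card (form_basis 4 :: (real ^ 'n \<Rightarrow> real) set) = fun_space.dim (forms 4 :: (real ^ 'n \<Rightarrow> real) set)"
  proof -
    have "fun_space.dim (fun_space.span (form_basis 4 :: (real ^ 'n \<Rightarrow> real) set)) =
        card (form_basis 4 :: (real ^ 'n \<Rightarrow> real) set)"
      by (rule fun_space.dim_span_eq_card_independent[OF independent_form_basis])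
    then show ?thesis by (simp add: span_form_basis)
  qed
  moreover have "f \<notin> B" using f(2) B(1) by blast
  ultimately show ?thesis using B(4) by simp
qed

text \<open>By irreducibility \<open>y = 4 * s\<close> satisfies no nontrivial integral relation of degree below \<open>3\<close>. With
  \<open>s = (cos t)\<^sup>2\<close> and \<open>t\<close> a multiple of \<open>\<pi> / 7\<close> the identity \<open>(sin (5 * t))\<^sup>2 = (sin (2 * t))\<^sup>2\<close> reads
  \<open>(poly (cheb 2) s)\<^sup>2 = y\<close>; so the three squares that remain after \<open>cheb 3\<close> vanishes are monic polynomials in \<open>y\<close>
  of the degrees \<open>0\<close>, \<open>2\<close>, \<open>1\<close>, and all their coefficients in the relation must be zero.\<close>

lemma cheb_squares_independent_3:
  fixes b :: "nat \<Rightarrow> int"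
  assumes root: "poly (cheb 3) s = 0" and sum: "(\<Sum>a\<le>3. of_int (b a) * (poly (cheb a) s)\<^sup>2) = 0"
  shows "b 1 = b 2"
proof -
  define y where "y = 4 * s"
  have V: "poly (cheb 1) s = y - 1" "poly (cheb 2) s = y\<^sup>2 - 3 * y + 1"
    "poly (cheb 3) s = y ^ 3 - 5 * y\<^sup>2 + 6 * y - 1"
    by (simp_all add: y_def eval_nat_numeral algebra_simps)
  have y: "y ^ 3 - 5 * y\<^sup>2 + 6 * y - 1 = 0" using root V(3) by simp
  have "(y\<^sup>2 - 3 * y + 1)\<^sup>2 - y = (y ^ 3 - 5 * y\<^sup>2 + 6 * y - 1) * (y - 1)" by algebra
  then have V2: "(y\<^sup>2 - 3 * y + 1)\<^sup>2 = y" using y by simp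
  have "{..3 :: nat} = {0, 1, 2, 3}" by auto
  then have "of_int (b 0) + of_int (b 1) * (y - 1)\<^sup>2 + of_int (b 2) * y = 0"
    using sum root by (simp add: V V2 del: One_nat_def)
  then have "int_eval [:b 0 + b 1, b 2 - 2 * b 1, b 1:] y = 0"
    by (simp add: map_poly_pCons algebra_simps power2_eq_square)
  moreover have "int_eval [:-1, 6, -5, 1:] y = 0"
    using y by (simp add: map_poly_pCons algebra_simps power2_eq_square power3_eq_cube)
  ultimately have "[:b 0 + b 1, b 2 - 2 * b 1, b 1:] = 0"
    by (intro irreducible_int_poly_minimal_degree[OF irreducible_cubic]) auto
  then show ?thesis by simp
qed

text \<open>The same argument for multiples of \<open>\<pi> / 11\<close>. Here \<open>7 * t\<close> and \<open>9 * t\<close> may be replaced by \<open>4 * t\<close> and \<open>2 * t\<close>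
  under the squared sine, which turns the squares of \<open>cheb 3\<close> and \<open>cheb 4\<close> into \<open>y * (y - 2)\<^sup>2\<close> and \<open>y\<close>.\<close>

lemma cheb_squares_independent_5:
  fixes b :: "nat \<Rightarrow> int"
  assumes root: "poly (cheb 5) s = 0" and sum: "(\<Sum>a\<le>5. of_int (b a) * (poly (cheb a) s)\<^sup>2) = 0"
  shows "b 3 = b 4"
proof -
  define y where "y = 4 * s"
  have V: "poly (cheb 1) s = y - 1" "poly (cheb 2) s = y\<^sup>2 - 3 * y + 1"
    "poly (cheb 3) s = y ^ 3 - 5 * y\<^sup>2 + 6 * y - 1"
    "poly (cheb 4) s = y ^ 4 - 7 * y ^ 3 + 15 * y\<^sup>2 - 10 * y + 1"
    "poly (cheb 5) s = y ^ 5 - 9 * y ^ 4 + 28 * y ^ 3 - 35 * y\<^sup>2 + 15 * y - 1"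
    by (simp_all add: y_def eval_nat_numeral algebra_simps)
  have y: "y ^ 5 - 9 * y ^ 4 + 28 * y ^ 3 - 35 * y\<^sup>2 + 15 * y - 1 = 0" using root V(5) by simp
  have "(y ^ 3 - 5 * y\<^sup>2 + 6 * y - 1)\<^sup>2 - y * (y - 2)\<^sup>2 =
      (y ^ 5 - 9 * y ^ 4 + 28 * y ^ 3 - 35 * y\<^sup>2 + 15 * y - 1) * (y - 1)" by algebra
  then have V3: "(y ^ 3 - 5 * y\<^sup>2 + 6 * y - 1)\<^sup>2 = y * (y - 2)\<^sup>2" using y by simp
  have "(y ^ 4 - 7 * y ^ 3 + 15 * y\<^sup>2 - 10 * y + 1)\<^sup>2 - y =
      (y ^ 5 - 9 * y ^ 4 + 28 * y ^ 3 - 35 * y\<^sup>2 + 15 * y - 1) * (y ^ 3 - 5 * y\<^sup>2 + 6 * y - 1)" by algebra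
  then have V4: "(y ^ 4 - 7 * y ^ 3 + 15 * y\<^sup>2 - 10 * y + 1)\<^sup>2 = y" using y by simp
  have "{..5 :: nat} = {0, 1, 2, 3, 4, 5}" by auto
  then have "of_int (b 0) + of_int (b 1) * (y - 1)\<^sup>2 + of_int (b 2) * (y\<^sup>2 - 3 * y + 1)\<^sup>2 +
      of_int (b 3) * (y * (y - 2)\<^sup>2) + of_int (b 4) * y = 0"
    using sum root by (simp add: V V3 V4 del: One_nat_def)
  then have "int_eval [:b 0 + b 1 + b 2, b 4 + 4 * b 3 - 6 * b 2 - 2 * b 1, b 1 + 11 * b 2 - 4 * b 3,
      b 3 - 6 * b 2, b 2:] y = 0"
    by (simp add: map_poly_pCons algebra_simps eval_nat_numeral)
  moreover have "int_eval [:-1, 15, -35, 28, -9, 1:] y = 0"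
    using y by (simp add: map_poly_pCons algebra_simps eval_nat_numeral)
  ultimately have "[:b 0 + b 1 + b 2, b 4 + 4 * b 3 - 6 * b 2 - 2 * b 1, b 1 + 11 * b 2 - 4 * b 3,
      b 3 - 6 * b 2, b 2:] = 0"
    by (intro irreducible_int_poly_minimal_degree[OF irreducible_quintic]) auto
  then show ?thesis by simp
qed

section \<open>Nonexistence\<close>

theorem theorem4p1:
  fixes k :: nat
  assumes "CARD('n::finite) \<ge> 2"
    and "k \<in> {3, 5}"
  shows "\<not> (\<exists>(X :: (real ^ 'n) set) w. minimal_cubature_formula k X w)"
proof
  assume "\<exists>(X :: (real ^ 'n) set) w. minimal_cubature_formula k X w"
  then obtain X :: "(real ^ 'n) set" and w where "minimal_cubature_formula k X w" by blast
  then interpret minimal_cubature k X w using assms(2) by unfold_locales auto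
  obtain x where x: "x \<in> Z" using Z_nonempty by blast
  define s where "s = 1 / (norm x)\<^sup>2"
  define H where "H j = fun_space.dim (forms (2 * j) :: (real ^ 'n \<Rightarrow> real) set)" for j
  define n where "n = card {z \<in> Z. norm z = norm x}"
  define b where "b a = 2 * int (H (k - a)) - int n" for a
  have root: "poly (cheb k) s = 0" using node_radius_root[OF x] by (simp add: s_def)
  have "2 * (\<Sum>a\<le>k. H (k - a) * (poly (cheb a) s)\<^sup>2) = n * (\<Sum>a\<le>k. (poly (cheb a) s)\<^sup>2)"
    using layer_count[OF x] by (simp add: H_def n_def s_def)
  then have sum: "(\<Sum>a\<le>k. of_int (b a) * (poly (cheb a) s)\<^sup>2) = 0"
    by (simp add: b_def left_diff_distrib sum_subtractf sum_distrib_left mult.assoc)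
  \<comment> \<open>These two indices belong to the forms of degree \<open>4\<close> and \<open>2\<close>.\<close>
  have "b (k - 2) = b (k - 1)"
    using assms(2) cheb_squares_independent_3[of s b] cheb_squares_independent_5[of s b] root sum
    by auto
  then have "H 2 = H 1" using assms(2) by (auto simp: b_def)
  then show False using dim_forms_2_less_4[OF assms(1)] by (simp add: H_def)
qed

end
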